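(* Let $\Delta=\Delta(n)>1$ be an integer (possibly depending on the positive integer $n$), and let $p=p(n)\in[0,1]$ satisfy $p=\omega\left(\Delta^{12}\,n^{-1/2}\log^3 n\right)$. Then a random graph $G\sim\mathcal G(n,p)$ is with high probability $\mathcal T(n,\Delta)$-universal, i.e. the probability that $G$ simultaneously contains a copy of every graph $T\in\mathcal T(n,\Delta)$ tends to $1$ as $n\to\infty$.
   Context: All graphs are finite and simple. $\mathcal G(n,p)$ is the random graph on $n$ vertices in which each pair of vertices forms an edge independently with probability $p$. $\mathcal T(n,\Delta)$ is the family of all forests on $n$ vertices with maximum degree at most $\Delta$. A graph $G$ is universal for a family $\mathcal H$ ($\mathcal H$-universal) if for every $H\in\mathcal H$ it contains a (not necessarily induced) subgraph isomorphic to $H$. "With high probability" means with probability tending to $1$ as $n\to\infty$; $f=\omega(g)$ means $f(n)/g(n)\to\infty$ as $n\to\infty$; $\log$ is the natural logarithm. *)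

theory Defs
  imports "HOL-Probability.Probability"
begin

datatype 'a graph = Graph (verts: "'a set") (edges: "'a set set")

definition simple_graph :: "'a graph \<Rightarrow> bool" where
  "simple_graph G \<longleftrightarrow> finite (verts G) \<and> (\<forall>e\<in>edges G. e \<subseteq> verts G \<and> card e = 2)"

definition subgraph :: "'a graph \<Rightarrow> 'a graph \<Rightarrow> bool" where
  "subgraph H G \<longleftrightarrow> simple_graph H \<and> verts H \<subseteq> verts G \<and> edges H \<subseteq> edges G"

definition isomorphic :: "'a graph \<Rightarrow> 'b graph \<Rightarrow> bool" where
  "isomorphic G H \<longleftrightarrow>
    (\<exists>f. bij_betw f (verts G) (verts H) \<and>
      (\<forall>u\<in>verts G. \<forall>v\<in>verts G. {u, v} \<in> edges G \<longleftrightarrow> {f u, f v} \<in> edges H))"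

definition universal :: "'a graph \<Rightarrow> 'b graph set \<Rightarrow> bool" where
  "universal G \<H> \<longleftrightarrow> (\<forall>H\<in>\<H>. \<exists>H'. subgraph H' G \<and> isomorphic H H')"

definition degree :: "'a graph \<Rightarrow> 'a \<Rightarrow> nat" where
  "degree G v = card {e \<in> edges G. v \<in> e}"

text \<open>
  A cycle is given by the list of its vertices in cyclic order, the first one not repeated at
  the end. The bound on the length keeps an edge from being traversed back and forth.
\<close>

definition cycle :: "'a graph \<Rightarrow> 'a list \<Rightarrow> bool" where
  "cycle G vs \<longleftrightarrow> length vs \<ge> 3 \<and> distinct vs \<and> set vs \<subseteq> verts G \<and>
    (\<forall>i<length vs. {vs ! i, vs ! (Suc i mod length vs)} \<in> edges G)"

definition forest :: "'a graph \<Rightarrow> bool" where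
  "forest G \<longleftrightarrow> simple_graph G \<and> (\<nexists>vs. cycle G vs)"

text \<open>
  Every finite graph is isomorphic to one whose vertices are natural numbers, and
  \<^const>\<open>universal\<close> depends on the members of the family only up to isomorphism, so
  the vertices may be taken from \<^typ>\<open>nat\<close>.
\<close>

definition bounded_degree_forests :: "nat \<Rightarrow> nat \<Rightarrow> nat graph set" where
  "bounded_degree_forests n \<Delta> =
    {T. forest T \<and> card (verts T) = n \<and> (\<forall>v\<in>verts T. degree T v \<le> \<Delta>)}"

definition vertex_pairs :: "nat \<Rightarrow> nat set set" where
  "vertex_pairs n = {e. e \<subseteq> {..<n} \<and> card e = 2}"

text \<open>
  The outcome \<open>X\<close> says for each pair whether it is an edge; its coordinates
  are independent. The parameter \<open>p\<close> is meant to lie in the unit interval.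
\<close>

definition gnp :: "nat \<Rightarrow> real \<Rightarrow> nat graph pmf" where
  "gnp n p =
    map_pmf (\<lambda>X. Graph {..<n} {e \<in> vertex_pairs n. X e})
      (Pi_pmf (vertex_pairs n) False (\<lambda>_. bernoulli_pmf p))"

end

theory Submission
  imports Defs
begin

text \<open>
  Let \<open>T\<close> be a forest on \<open>n\<close> vertices with maximum degree at most \<open>\<Delta>\<close>. A third of its vertices
  have degree at most 2; choose a set \<open>I\<close> of \<open>m\<close> of them, with \<open>m\<close> of order \<open>n / \<Delta> ^ 6\<close>, that are pairwise
  far apart, and send the neighbours of the \<open>i\<close>-th vertex of \<open>I\<close> into the fixed pair \<open>{2 i, 2 i + 1}\<close>.
  The remaining vertices outside \<open>I\<close> are peeled off in rounds, each round removing the vertices that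
  have at most two neighbours among the surviving ones and the neighbours of \<open>I\<close>. Each round removes
  at least a sixth of the survivors, so there are \<open>O (log n)\<close> rounds. Splitting every round by a colouring
  that separates vertices at distance at most 2 gives \<open>t = O (\<Delta> ^ 2 log n)\<close> stages.

  Embedding the stages in reverse order of peeling, each stage asks for a matching: every new
  vertex must go to a common neighbour of at most two images already chosen, and these sets of
  images are pairwise disjoint. Hall's condition holds for small sets because a fresh block of
  vertices of \<open>G\<close> is reserved for each stage, and for large ones because large families of pairs reach
  almost everything. In the last stage, which embeds \<open>I\<close>, no vertex is left over; there the fixed
  pairs guarantee that every small set of unused vertices is reached as well. The required
  properties of \<open>G\<close> do not mention \<open>T\<close>, and since \<open>p ^ 2 n\<close> exceeds \<open>\<Delta> ^ 24 ln ^ 6 n\<close>, a union bound shows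
  that they hold with probability at least \<open>1 - 3 / n\<close>.
\<close>

section \<open>Matchings, greedy choices and forests\<close>

text \<open>Halmos-Vaughan induction on \<open>card A\<close>. If a nonempty proper subset X is
  tight, it is matched within its neighbourhood and the rest outside that neighbourhood. Otherwise
  every nonempty proper subset has a surplus of at least one, so any a may take any b in
  \<open>N a\<close>, and deleting b is harmless.\<close>

lemma hall_marriage:
  fixes N :: "'a \<Rightarrow> 'b set"
  assumes "finite A" and "\<And>a. a \<in> A \<Longrightarrow> finite (N a)"
    and "\<And>X. X \<subseteq> A \<Longrightarrow> card X \<le> card (\<Union>(N ` X))"
  shows "\<exists>f. inj_on f A \<and> (\<forall>a\<in>A. f a \<in> N a)"
  using assms
proof (induction "card A" arbitrary: A N rule: less_induct)
  case less
  note finA = less.prems(1) and finN = less.prems(2) and H = less.prems(3)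
  show ?case
  proof (cases "A = {}")
    case False
    then obtain a where a: "a \<in> A" by blast
    show ?thesis
    proof (cases "\<exists>X. X \<noteq> {} \<and> X \<subset> A \<and> card (\<Union>(N ` X)) \<le> card X")
      case True
      then obtain X where X: "X \<noteq> {}" "X \<subset> A" "card (\<Union>(N ` X)) \<le> card X" by blast
      have finX: "finite X" using X finA finite_subset by blast
      have "\<exists>f. inj_on f X \<and> (\<forall>a\<in>X. f a \<in> N a)"
      proof (rule less.hyps)
        show "card X < card A" using X(2) finA by (rule psubset_card_mono[rotated])
        show "finite X" by (rule finX)
        show "finite (N a)" if "a \<in> X" for a using that X finN by blast
        show "card Y \<le> card (\<Union>(N ` Y))" if "Y \<subseteq> X" for Y using that X H by blast
      qed
      then obtain f where f: "inj_on f X" "\<And>a. a \<in> X \<Longrightarrow> f a \<in> N a" by blast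
      let ?U = "\<Union>(N ` X)"
      have "\<exists>g. inj_on g (A - X) \<and> (\<forall>a\<in>A - X. g a \<in> N a - ?U)"
      proof (rule less.hyps)
        show "card (A - X) < card A"
          using X finA by (intro psubset_card_mono) auto
        show "finite (A - X)" using finA by simp
        show "finite (N a - ?U)" if "a \<in> A - X" for a using that finN by blast
        show "card Y \<le> card (\<Union>a\<in>Y. N a - ?U)" if Y: "Y \<subseteq> A - X" for Y
        proof -
          have finY: "finite Y" using Y finA finite_subset by blast
          have XY: "X \<union> Y \<subseteq> A" using Y X by blast
          \<comment> \<open>Hall's condition for the union of X and Y leaves at least
            \<open>card Y\<close> neighbours outside \<open>?U\<close>, because the tight set X uses
            up at most \<open>card X\<close> of them.\<close>
          have "card X + card Y = card (X \<union> Y)"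
            using Y finX finY by (subst card_Un_disjoint) auto
          also have "\<dots> \<le> card (\<Union>(N ` (X \<union> Y)))" using XY by (rule H)
          also have "\<Union>(N ` (X \<union> Y)) = ?U \<union> (\<Union>a\<in>Y. N a - ?U)" by blast
          also have "card \<dots> \<le> card ?U + card (\<Union>a\<in>Y. N a - ?U)" by (rule card_Un_le)
          finally show ?thesis using X(3) by linarith
        qed
      qed
      then obtain g where g: "inj_on g (A - X)" "\<And>a. a \<in> A - X \<Longrightarrow> g a \<in> N a - ?U" by blast
      let ?h = "\<lambda>a. if a \<in> X then f a else g a"
      have "inj_on ?h A"
      proof (rule inj_onI)
        fix x y assume xy: "x \<in> A" "y \<in> A" and eq: "?h x = ?h y"
        have neq: "f u \<noteq> g v" if "u \<in> X" "v \<in> A - X" for u v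
          using f(2)[OF that(1)] g(2)[OF that(2)] that by auto
        show "x = y"
          using xy eq neq[of x y] neq[of y x] inj_onD[OF f(1), of x y] inj_onD[OF g(1), of x y]
          by (cases "x \<in> X"; cases "y \<in> X") auto
      qed
      moreover have "\<forall>a\<in>A. ?h a \<in> N a" using f(2) g(2) by auto
      ultimately show ?thesis by blast
    next
      case False
      have "N a \<noteq> {}" using H[of "{a}"] a by auto
      then obtain b where b: "b \<in> N a" by blast
      have "\<exists>f. inj_on f (A - {a}) \<and> (\<forall>x\<in>A - {a}. f x \<in> N x - {b})"
      proof (rule less.hyps)
        show "card (A - {a}) < card A" using a finA by (rule card_Diff1_less[rotated])
        show "finite (A - {a})" using finA by simp
        show "finite (N x - {b})" if "x \<in> A - {a}" for x using that finN by blast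
        show "card Y \<le> card (\<Union>x\<in>Y. N x - {b})" if Y: "Y \<subseteq> A - {a}" for Y
        proof (cases "Y = {}")
          case nonempty: False
          have "Y \<subset> A" using Y a by blast
          with False nonempty have "card Y < card (\<Union>(N ` Y))" by (meson not_le)
          moreover have "(\<Union>x\<in>Y. N x - {b}) = \<Union>(N ` Y) - {b}" by blast
          moreover have "card (\<Union>(N ` Y)) - 1 \<le> card (\<Union>(N ` Y) - {b})"
            by (simp add: card_Diff_singleton_if)
          ultimately show ?thesis by simp
        qed simp
      qed
      then obtain f where f: "inj_on f (A - {a})" "\<And>x. x \<in> A - {a} \<Longrightarrow> f x \<in> N x - {b}" by blast
      have "inj_on (f(a := b)) A"
      proof (rule inj_onI)
        fix x y assume "x \<in> A" "y \<in> A" and "(f(a := b)) x = (f(a := b)) y"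
        then show "x = y"
          using f(2)[of x] f(2)[of y] inj_onD[OF f(1), of x y] by (auto split: if_splits)
      qed
      moreover have "\<forall>x\<in>A. (f(a := b)) x \<in> N x" using f(2) b by auto
      ultimately show ?thesis by blast
    qed
  qed simp
qed

text \<open>Each chosen element excludes its R-neighbourhood of size at most q. While fewer than m
  are chosen, these neighbourhoods cannot cover D.\<close>

lemma greedy_independent:
  fixes R :: "('a \<times> 'a) set"
  assumes "finite D" and "sym R" and "\<And>v. (v, v) \<in> R"
    and ball: "\<And>v. v \<in> D \<Longrightarrow> finite (R `` {v}) \<and> card (R `` {v}) \<le> q"
    and "0 < q" and "m * q \<le> card D"
  shows "\<exists>I\<subseteq>D. card I = m \<and> (\<forall>v\<in>I. \<forall>w\<in>I. (v, w) \<in> R \<longrightarrow> v = w)"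
  using assms(6)
proof (induction m)
  case (Suc m)
  then obtain I where I: "I \<subseteq> D" "card I = m" "\<forall>v\<in>I. \<forall>w\<in>I. (v, w) \<in> R \<longrightarrow> v = w" by auto
  have finI: "finite I" using I(1) assms(1) finite_subset by blast
  have "card (\<Union>v\<in>I. R `` {v}) \<le> (\<Sum>v\<in>I. card (R `` {v}))" by (rule card_UN_le[OF finI])
  also have "\<dots> \<le> m * q" using sum_bounded_above[of I "\<lambda>v. card (R `` {v})" q] ball I(1,2) by auto
  also have "\<dots> < card D" using Suc.prems \<open>0 < q\<close> by simp
  finally have "\<not> D \<subseteq> (\<Union>v\<in>I. R `` {v})"
    using card_mono[of "\<Union>v\<in>I. R `` {v}" D] finI I(1) ball by fastforce
  then obtain w where w: "w \<in> D" "\<And>v. v \<in> I \<Longrightarrow> (v, w) \<notin> R" by blast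
  have "w \<notin> I" using w(2) assms(3) by blast
  then have "card (insert w I) = Suc m" using finI I(2) by simp
  moreover have "\<forall>v\<in>insert w I. \<forall>u\<in>insert w I. (v, u) \<in> R \<longrightarrow> v = u"
    using I(3) w(2) \<open>sym R\<close> by (auto dest: symD)
  ultimately show ?case using w(1) I(1) by (intro exI[of _ "insert w I"]) auto
qed auto

text \<open>Since R is reflexive, the bound q also counts the vertex itself; at most q - 1 colours
  are forbidden when it is coloured, so q colours suffice.\<close>

lemma greedy_colouring:
  fixes R :: "('a \<times> 'a) set"
  assumes "finite V" and "sym R" and "\<And>v. (v, v) \<in> R"
    and "\<And>v. v \<in> V \<Longrightarrow> finite (R `` {v}) \<and> card (R `` {v}) \<le> q"
  shows "\<exists>c. \<forall>v\<in>V. c v < q \<and> (\<forall>w\<in>V. (v, w) \<in> R \<longrightarrow> c v = c w \<longrightarrow> v = w)"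
  using assms(1,4)
proof (induction V rule: finite_induct)
  case (insert x V)
  then obtain c where c: "\<forall>v\<in>V. c v < q \<and> (\<forall>w\<in>V. (v, w) \<in> R \<longrightarrow> c v = c w \<longrightarrow> v = w)" by auto
  let ?B = "R `` {x} - {x}"
  have B: "finite (R `` {x})" "card (R `` {x}) \<le> q" using insert.prems by auto
  have "card (c ` ?B) \<le> card ?B" using B by (intro card_image_le) auto
  also have "\<dots> < card (R `` {x})" using assms(3) B(1) by (intro card_Diff1_less) auto
  also have "\<dots> \<le> card {..<q}" using B(2) by simp
  finally have "\<not> {..<q} \<subseteq> c ` ?B" using card_mono[of "c ` ?B" "{..<q}"] B(1) by fastforce
  then obtain j where j: "j < q" "j \<notin> c ` ?B" by blast
  have "\<forall>v\<in>insert x V. (c(x := j)) v < q \<and>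
      (\<forall>w\<in>insert x V. (v, w) \<in> R \<longrightarrow> (c(x := j)) v = (c(x := j)) w \<longrightarrow> v = w)"
    using c j insert.hyps(2) \<open>sym R\<close> by (auto dest: symD split: if_splits)
  then show ?case by blast
qed auto

lemma card_relpow_image_le:
  fixes R :: "('a \<times> 'a) set"
  assumes "\<And>v. finite (R `` {v}) \<and> card (R `` {v}) \<le> d"
  shows "finite ((R ^^ j) `` {v}) \<and> card ((R ^^ j) `` {v}) \<le> d ^ j"
proof (induction j)
  case (Suc j)
  have eq: "(R ^^ Suc j) `` {v} = (\<Union>u\<in>(R ^^ j) `` {v}. R `` {u})" by auto
  have "card \<dots> \<le> (\<Sum>u\<in>(R ^^ j) `` {v}. card (R `` {u}))"
    using Suc by (intro card_UN_le) auto
  also have "\<dots> \<le> card ((R ^^ j) `` {v}) * d"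
    using sum_bounded_above[of "(R ^^ j) `` {v}" "\<lambda>u. card (R `` {u})" d] assms by simp
  also have "\<dots> \<le> d ^ j * d" using Suc by simp
  finally have "card ((R ^^ Suc j) `` {v}) \<le> d ^ Suc j" by (simp only: eq power_Suc mult.commute)
  moreover have "finite ((R ^^ Suc j) `` {v})" unfolding eq using Suc assms by blast
  ultimately show ?case by blast
qed simp

lemma sym_relpow: "sym R \<Longrightarrow> sym (R ^^ j)"
proof (induction j)
  case (Suc j)
  show ?case
  proof (rule symI)
    fix x y assume "(x, y) \<in> R ^^ Suc j"
    then obtain z where "(x, z) \<in> R ^^ j" "(z, y) \<in> R" by auto
    then show "(y, x) \<in> R ^^ Suc j" using Suc by (intro relpow_Suc_I2[of y z]) (auto dest: symD)
  qed
qed (auto intro: symI)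

section \<open>Degrees in acyclic graphs\<close>

locale bounded_forest =
  fixes T :: "'a graph" and \<Delta> :: nat
  assumes forest: "forest T" and degree_le: "\<And>v. v \<in> verts T \<Longrightarrow> degree T v \<le> \<Delta>"
begin

definition adj :: "'a \<Rightarrow> 'a \<Rightarrow> bool" where "adj u v \<longleftrightarrow> {u, v} \<in> edges T"

definition nb :: "'a \<Rightarrow> 'a set" where "nb u = {v. adj u v}"

lemma simple: "simple_graph T" using forest by (simp add: forest_def)

lemma finite_verts: "finite (verts T)" using simple by (simp add: simple_graph_def)

lemma adj_sym: "adj u v \<Longrightarrow> adj v u" by (simp add: adj_def insert_commute)

lemma adj_verts: "adj u v \<Longrightarrow> u \<in> verts T \<and> v \<in> verts T"
  using simple by (auto simp: adj_def simple_graph_def)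

lemma adj_neq: "adj u v \<Longrightarrow> u \<noteq> v"
  using simple by (auto simp: adj_def simple_graph_def)

lemma in_nb_iff [simp]: "v \<in> nb u \<longleftrightarrow> adj u v" by (simp add: nb_def)

lemma nb_subset: "nb u \<subseteq> verts T" using adj_verts by auto

lemma finite_nb [simp]: "finite (nb u)" using nb_subset finite_verts finite_subset by blast

lemma card_nb_le: "card (nb u) \<le> \<Delta>"
proof (cases "u \<in> verts T")
  case True
  have "edges T \<subseteq> Pow (verts T)" using simple by (auto simp: simple_graph_def)
  then have "finite (edges T)" using finite_verts by (meson finite_Pow_iff finite_subset)
  moreover have "inj_on (\<lambda>v. {u, v}) (nb u)" by (auto simp: inj_on_def doubleton_eq_iff)
  moreover have "(\<lambda>v. {u, v}) ` nb u \<subseteq> {e \<in> edges T. u \<in> e}" by (auto simp: adj_def)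
  ultimately have "card (nb u) \<le> degree T u"
    unfolding degree_def by (intro card_inj_on_le) auto
  then show ?thesis using degree_le[OF True] by simp
next
  case False
  then have "nb u = {}" using adj_verts by auto
  then show ?thesis by simp
qed

text \<open>Acyclicity without the modular indexing of \<open>cycle\<close>: a cycle written out as
  an explicit list can then be refuted by simplification.\<close>

lemma no_cycle:
  assumes "length xs \<ge> 3" "distinct xs" "successively adj xs" "adj (last xs) (hd xs)"
  shows False
proof -
  have ne: "xs \<noteq> []" using assms(1) by auto
  have step: "{xs ! i, xs ! (Suc i mod length xs)} \<in> edges T" if "i < length xs" for i
  proof (cases "Suc i < length xs")
    case True
    then show ?thesis using assms(3) successively_nth[OF assms(3) True] by (simp add: adj_def)
  next
    case False
    then have i: "Suc i = length xs" "i = length xs - 1" using that by simp_all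
    have "last xs = xs ! i" using i(2) ne by (simp add: last_conv_nth)
    then show ?thesis using assms(4) ne by (simp add: adj_def i(1) hd_conv_nth)
  qed
  have "set xs \<subseteq> verts T"
  proof
    fix x assume "x \<in> set xs"
    then obtain i where "i < length xs" "x = xs ! i" by (auto simp: in_set_conv_nth)
    then show "x \<in> verts T" using step[of i] adj_verts[of x] by (auto simp: adj_def)
  qed
  then have "cycle T xs" using assms(1,2) step by (simp add: cycle_def)
  then show False using forest by (auto simp: forest_def)
qed

text \<open>In an acyclic graph an end of a longest path in \<open>S\<close> has at most one neighbour in \<open>S\<close>.\<close>

lemma exists_low_degree:
  assumes "S \<subseteq> verts T" and "S \<noteq> {}"
  shows "\<exists>v\<in>S. card (nb v \<inter> S) \<le> 1"
proof (rule ccontr)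
  assume "\<not> ?thesis"
  then have high: "card (nb v \<inter> S) \<ge> 2" if "v \<in> S" for v using that by force
  have finS: "finite S" using assms(1) finite_verts finite_subset by blast
  define P where "P xs \<longleftrightarrow> xs \<noteq> [] \<and> set xs \<subseteq> S \<and> distinct xs \<and> successively adj xs" for xs
  obtain s where "s \<in> S" using assms(2) by blast
  then have "P [s]" by (simp add: P_def)
  moreover have "\<forall>xs. P xs \<longrightarrow> length xs \<le> card S"
  proof (intro allI impI)
    fix xs assume "P xs"
    then have "length xs = card (set xs)" "set xs \<subseteq> S" by (auto simp: P_def distinct_card)
    then show "length xs \<le> card S" using card_mono[OF finS] by simp
  qed
  ultimately obtain xs where xs: "P xs" "\<And>ys. P ys \<Longrightarrow> length ys \<le> length xs"
    using ex_has_greatest_nat[of P "[s]" length "Suc (card S)"] less_Suc_eq_le by blast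
  obtain x xs' where split: "xs = x # xs'" using xs(1) by (auto simp: P_def neq_Nil_conv)
  have "x \<in> S" using xs(1) split by (simp add: P_def)
  \<comment> \<open>A neighbour of x in S off the path could be prepended, against the maximal
    length.\<close>
  have inside: "y \<in> set xs'" if "y \<in> nb x \<inter> S" for y
  proof (rule ccontr)
    assume "y \<notin> set xs'"
    then have "P (y # xs)" using xs(1) that adj_sym adj_neq[of x y] unfolding P_def split
      by (auto simp: successively_Cons)
    then show False using xs(2)[of "y # xs"] by simp
  qed
  \<comment> \<open>x has two neighbours in S, so one differs from its successor on the path and
    closes a cycle with the initial segment. If \<open>xs'\<close> is empty, \<open>hd xs'\<close>
    is arbitrary, but \<open>inside\<close> already gives a contradiction.\<close>
  have "\<exists>y\<in>nb x \<inter> S. y \<noteq> hd xs'"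
  proof (rule ccontr)
    assume "\<not> ?thesis"
    then have "nb x \<inter> S \<subseteq> {hd xs'}" by blast
    then have "card (nb x \<inter> S) \<le> 1" using card_mono[of "{hd xs'}"] by fastforce
    then show False using high[OF \<open>x \<in> S\<close>] by simp
  qed
  then obtain y where y: "adj x y" "y \<in> S" "y \<noteq> hd xs'" by auto
  then have "y \<in> set xs'" using inside by simp
  then obtain as bs where asbs: "xs' = as @ y # bs" using split_list by metis
  have "as \<noteq> []" using y(3) asbs by auto
  have "P xs" by (rule xs(1))
  then have "distinct (x # as @ [y])" "successively adj (x # as @ [y])"
    unfolding P_def split asbs
    by (auto simp: successively_Cons successively_append_iff hd_append split: if_splits)
  moreover have "length (x # as @ [y]) \<ge> 3" using \<open>as \<noteq> []\<close> by (cases as) auto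
  moreover have "adj (last (x # as @ [y])) (hd (x # as @ [y]))" using y(1) adj_sym by simp
  ultimately show False using no_cycle by blast
qed

text \<open>Removing a vertex with at most one neighbour in S lowers the degree sum by at most 2:
  once for the vertex and once for its neighbour.\<close>

lemma sum_degrees_le:
  assumes "S \<subseteq> verts T"
  shows "(\<Sum>v\<in>S. card (nb v \<inter> S)) \<le> 2 * card S"
  using assms
proof (induction "card S" arbitrary: S)
  case 0
  then have "S = {}" using finite_verts finite_subset by fastforce
  then show ?case by simp
next
  case (Suc s)
  then have finS: "finite S" and "S \<noteq> {}" by (auto intro: card_ge_0_finite)
  then obtain v where v: "v \<in> S" "card (nb v \<inter> S) \<le> 1" using exists_low_degree Suc.prems by blast
  let ?S = "S - {v}"
  have card_v: "card S = Suc (card ?S)" using card.remove[OF finS v(1)] .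
  have split: "card (nb u \<inter> S) = card (nb u \<inter> ?S) + (if u \<in> nb v then 1 else 0)" for u
  proof (cases "u \<in> nb v")
    case True
    then have "nb u \<inter> S = insert v (nb u \<inter> ?S)" using v(1) adj_sym by auto
    then show ?thesis using True by simp
  next
    case False
    then have "nb u \<inter> S = nb u \<inter> ?S" using adj_sym by auto
    then show ?thesis using False by simp
  qed
  have "(\<Sum>u\<in>S. card (nb u \<inter> S)) = card (nb v \<inter> S) + (\<Sum>u\<in>?S. card (nb u \<inter> S))"
    using v(1) finS by (simp add: sum.remove)
  also have "(\<Sum>u\<in>?S. card (nb u \<inter> S)) = (\<Sum>u\<in>?S. card (nb u \<inter> ?S)) + card (?S \<inter> nb v)"
    unfolding split sum.distrib using finS by (simp add: sum.If_cases nb_def)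
  also have "(\<Sum>u\<in>?S. card (nb u \<inter> ?S)) \<le> 2 * card ?S"
    using Suc card_v by (intro Suc.hyps(1)) auto
  also have "card (?S \<inter> nb v) \<le> card (nb v \<inter> S)" by (intro card_mono) auto
  finally show ?case using v(2) card_v by linarith
qed

end

section \<open>Peeling a forest around a sparse set of vertices\<close>

context bounded_forest
begin

text \<open>With reflexive steps, \<open>step ^^ j\<close> means distance at most j.\<close>

definition step :: "('a \<times> 'a) set" where "step = {(u, v). u = v \<or> adj u v}"

lemma step_refl [simp]: "(v, v) \<in> step" by (simp add: step_def)

lemma adj_step: "adj u v \<Longrightarrow> (u, v) \<in> step" by (simp add: step_def)

lemma sym_step: "sym step" using adj_sym by (auto simp: step_def intro: symI)

lemma card_step_image: "finite (step `` {v}) \<and> card (step `` {v}) \<le> Suc \<Delta>"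
proof -
  have "step `` {v} = insert v (nb v)" by (auto simp: step_def)
  moreover have "card (insert v (nb v)) \<le> Suc (card (nb v))" by (rule card_insert_le_m1) auto
  ultimately show ?thesis using card_nb_le[of v] by simp
qed

lemma refl_step_power: "(v, v) \<in> step ^^ j"
  by (induction j) (auto intro: relpow_Suc_I)

text \<open>The vertices of degree at least 3 contribute three each to a degree sum of at most twice
  the number of vertices, so they make up at most two thirds.\<close>

lemma card_low_degree: "card (verts T) \<le> 3 * card {v \<in> verts T. card (nb v) \<le> 2}"
proof -
  let ?V = "verts T" and ?L = "{v \<in> verts T. card (nb v) \<le> 2}"
  have "3 * card (?V - ?L) = (\<Sum>v\<in>?V - ?L. 3)" by simp
  also have "\<dots> \<le> (\<Sum>v\<in>?V - ?L. card (nb v \<inter> ?V))"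
    using nb_subset by (intro sum_mono) (auto simp: Int_absorb2)
  also have "\<dots> \<le> (\<Sum>v\<in>?V. card (nb v \<inter> ?V))" using finite_verts by (intro sum_mono2) auto
  also have "\<dots> \<le> 2 * card ?V" by (rule sum_degrees_le) simp
  finally have "3 * card (?V - ?L) \<le> 2 * card ?V" .
  moreover have "card (?V - ?L) = card ?V - card ?L"
    using finite_verts by (intro card_Diff_subset) auto
  ultimately show ?thesis by linarith
qed

end

section \<open>Local structure around vertices that are far apart\<close>

locale separated_forest = bounded_forest T \<Delta> for T :: "'a graph" and \<Delta> +
  fixes I :: "'a set"
  assumes I_subset: "I \<subseteq> verts T"
    and separated: "\<And>v w. v \<in> I \<Longrightarrow> w \<in> I \<Longrightarrow> (v, w) \<in> step ^^ 6 \<Longrightarrow> v = w"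
    and card_nb_I: "\<And>v. v \<in> I \<Longrightarrow> card (nb v) \<le> 2"
begin

definition fringe :: "'a set" where "fringe = \<Union>(nb ` I)"

definition rest :: "'a set" where "rest = verts T - I - fringe"

text \<open>Shorter walks are padded with reflexive steps. Length six is what
  \<open>attached_no_common_nb\<close> needs, where the walk is v, a, r, x, s, b, w.\<close>

lemma walk_eq:
  assumes "v \<in> I" "w \<in> I" "(v, a) \<in> step" "(a, b) \<in> step" "(b, c) \<in> step" "(c, d) \<in> step"
    "(d, e) \<in> step" "(e, w) \<in> step"
  shows "v = w"
proof (rule separated)
  have "(v, w) \<in> step ^^ Suc (Suc (Suc (Suc (Suc (Suc 0)))))"
    by (rule relpow_Suc_I2 assms relpow_0_I)+
  then show "(v, w) \<in> step ^^ 6" by (simp add: numeral_eq_Suc)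
qed (use assms in auto)

lemma finite_rest: "finite rest" using finite_verts by (simp add: rest_def)

lemma finite_I: "finite I" using I_subset finite_verts finite_subset by blast

lemma fringe_subset: "fringe \<subseteq> verts T" using nb_subset by (auto simp: fringe_def)

lemma I_independent: "v \<in> I \<Longrightarrow> w \<in> I \<Longrightarrow> \<not> adj v w"
  using walk_eq[of v w w w w w w] adj_step adj_neq by auto

lemma fringe_I_disjoint: "fringe \<inter> I = {}" using I_independent by (auto simp: fringe_def)

lemma nb_I_disjoint: "v \<in> I \<Longrightarrow> w \<in> I \<Longrightarrow> v \<noteq> w \<Longrightarrow> nb v \<inter> nb w = {}"
  using walk_eq[of v w] adj_step adj_sym step_refl in_nb_iff by (metis disjoint_iff)

text \<open>This lemma and the next three share one argument: the forbidden configuration is so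
  short that the vertices of I involved coincide by \<open>walk_eq\<close>, and then it contains a
  cycle.\<close>

lemma fringe_independent:
  assumes "a \<in> fringe" "b \<in> fringe" shows "\<not> adj a b"
proof
  assume ab: "adj a b"
  obtain v w where vw: "v \<in> I" "w \<in> I" "adj v a" "adj w b" using assms by (auto simp: fringe_def)
  have "v = w" using walk_eq[of v w a b w w w] vw ab adj_step adj_sym by simp
  then show False using no_cycle[of "[v, a, b]"] vw ab adj_neq adj_sym by simp
qed

lemma card_nb_fringe_le:
  assumes "r \<in> rest" shows "card (nb r \<inter> fringe) \<le> 1"
proof -
  have "a = b" if ab: "a \<in> nb r \<inter> fringe" "b \<in> nb r \<inter> fringe" for a b
  proof (rule ccontr)
    assume "a \<noteq> b"
    obtain v w where vw: "v \<in> I" "w \<in> I" "adj v a" "adj w b" using ab by (auto simp: fringe_def)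
    have rr: "adj r a" "adj r b" using ab by auto
    have "v = w" using walk_eq[of v w a r b w w] vw rr adj_step adj_sym by simp
    moreover have "r \<noteq> v" using assms vw by (auto simp: rest_def)
    ultimately show False
      using no_cycle[of "[v, a, r, b]"] vw rr \<open>a \<noteq> b\<close> adj_neq adj_sym by simp
  qed
  then show ?thesis by (metis card_le_Suc0_iff_eq One_nat_def finite_Int finite_nb)
qed

text \<open>The cycle has length 3 or 5. In the peeling bound this keeps the chosen neighbours
  outside the set of attached survivors.\<close>

lemma attached_nonadjacent:
  assumes "r \<in> rest" "s \<in> rest" "adj r a" "adj s b" "a \<in> fringe" "b \<in> fringe"
  shows "\<not> adj r s"
proof
  assume rs: "adj r s"
  obtain v w where vw: "v \<in> I" "w \<in> I" "adj v a" "adj w b" using assms by (auto simp: fringe_def)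
  have eq: "v = w" using walk_eq[of v w a r s b w] vw rs assms adj_step adj_sym by simp
  have ne: "r \<noteq> v" "s \<noteq> v" "r \<noteq> a" "r \<noteq> b" "s \<noteq> a" "s \<noteq> b" "v \<noteq> a" "v \<noteq> b" "r \<noteq> s"
    using assms vw fringe_I_disjoint rs adj_neq by (auto simp: rest_def)
  show False
  proof (cases "a = b")
    case True
    then show False using no_cycle[of "[r, s, a]"] rs assms ne adj_sym by simp
  next
    case False
    then show False using no_cycle[of "[r, s, b, v, a]"] rs assms vw eq ne adj_sym by simp
  qed
qed

text \<open>The cycle has length 4 or 6. In the peeling bound this makes the choice of neighbours
  injective.\<close>

lemma attached_no_common_nb:
  assumes "r \<in> rest" "s \<in> rest" "x \<in> rest" "adj r a" "adj s b" "a \<in> fringe" "b \<in> fringe" "r \<noteq> s" "adj r x" "adj s x"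
  shows False
proof -
  obtain v w where vw: "v \<in> I" "w \<in> I" "adj v a" "adj w b" using assms by (auto simp: fringe_def)
  have eq: "v = w" using walk_eq[of v w a r x s b] vw assms adj_step adj_sym by simp
  have ne: "r \<noteq> v" "s \<noteq> v" "x \<noteq> v" "r \<noteq> a" "r \<noteq> b" "s \<noteq> a" "s \<noteq> b" "x \<noteq> a" "x \<noteq> b"
    "v \<noteq> a" "v \<noteq> b" "r \<noteq> x" "s \<noteq> x"
    using assms vw fringe_I_disjoint adj_neq by (auto simp: rest_def)
  show False
  proof (cases "a = b")
    case True
    then show False using no_cycle[of "[r, x, s, a]"] assms ne adj_sym by simp
  next
    case False
    then show False using no_cycle[of "[r, x, s, b, v, a]"] assms vw eq ne adj_sym by simp
  qed
qed

section \<open>Peeling in rounds\<close>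

definition unpeeled :: "'a set \<Rightarrow> 'a set" where
  "unpeeled X = {r \<in> X. 3 \<le> card (nb r \<inter> (X \<union> fringe))}"

text \<open>A survivor has at least three neighbours in X, or at least two if it belongs to the set
  A of survivors with a neighbour in \<open>fringe\<close>. Mapping each vertex of A to a neighbour
  in X is injective and avoids A, so A is at most half of X. The degree bound 2 |X| then gives 3
  |\<open>unpeeled X\<close>| at most 2 |X| + |X| / 2.\<close>

lemma card_unpeeled_le:
  assumes X: "X \<subseteq> rest"
  shows "6 * card (unpeeled X) \<le> 5 * card X"
proof -
  have finX: "finite X" using X finite_rest finite_subset by blast
  have unpeeled_sub: "unpeeled X \<subseteq> X" by (auto simp: unpeeled_def)
  define A where "A = {r \<in> unpeeled X. nb r \<inter> fringe \<noteq> {}}"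
  have A_sub: "A \<subseteq> unpeeled X" by (auto simp: A_def)
  have finA: "finite A" using A_sub unpeeled_sub finX by (meson finite_subset)
  have XM: "X \<inter> fringe = {}" using X by (auto simp: rest_def)
  have deg: "3 \<le> card (nb r \<inter> X) + card (nb r \<inter> fringe)" if "r \<in> unpeeled X" for r
  proof -
    have "nb r \<inter> (X \<union> fringe) = (nb r \<inter> X) \<union> (nb r \<inter> fringe)" by blast
    then have "card (nb r \<inter> (X \<union> fringe)) = card (nb r \<inter> X) + card (nb r \<inter> fringe)"
      using XM by (simp add: card_Un_disjoint disjoint_iff)
    then show ?thesis using that by (simp add: unpeeled_def)
  qed
  have M1: "card (nb r \<inter> fringe) \<le> 1" if "r \<in> unpeeled X" for r
    using that unpeeled_sub X card_nb_fringe_le by blast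
  have "\<forall>r\<in>A. \<exists>x. x \<in> nb r \<inter> X"
  proof
    fix r assume "r \<in> A"
    then have "0 < card (nb r \<inter> X)" using deg[of r] M1[of r] A_sub by auto
    then have "nb r \<inter> X \<noteq> {}" by auto
    then show "\<exists>x. x \<in> nb r \<inter> X" by blast
  qed
  then obtain \<phi> where \<phi>: "\<And>r. r \<in> A \<Longrightarrow> \<phi> r \<in> nb r \<inter> X" by metis
  have A_rest: "r \<in> rest" "\<exists>a\<in>fringe. adj r a" if "r \<in> A" for r
    using that A_sub unpeeled_sub X by (auto simp: A_def)
  have "inj_on \<phi> A"
  proof (rule inj_onI)
    fix r s assume rs: "r \<in> A" "s \<in> A" and eq: "\<phi> r = \<phi> s"
    obtain a b where "a \<in> fringe" "b \<in> fringe" "adj r a" "adj s b" using A_rest(2) rs by blast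
    then show "r = s"
      using attached_no_common_nb[of r s "\<phi> r" a b] \<phi>[OF rs(1)] \<phi>[OF rs(2)] eq A_rest(1) rs X
        by auto
  qed
  moreover have "\<phi> ` A \<subseteq> X - A"
  proof
    fix x assume "x \<in> \<phi> ` A"
    then obtain r where r: "r \<in> A" "x = \<phi> r" by blast
    have "x \<notin> A"
    proof
      assume "x \<in> A"
      obtain a b where "a \<in> fringe" "b \<in> fringe" "adj r a" "adj x b" using A_rest(2) r(1) \<open>x \<in> A\<close>
        by blast
      then show False
        using attached_nonadjacent[of r x a b] \<phi>[OF r(1)] r A_rest(1) \<open>x \<in> A\<close> by auto
    qed
    then show "x \<in> X - A" using \<phi>[OF r(1)] r(2) by blast
  qed
  ultimately have "card A \<le> card (X - A)" using finX by (intro card_inj_on_le) auto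
  moreover have "card (X - A) = card X - card A"
    using A_sub unpeeled_sub finA by (intro card_Diff_subset) auto
  ultimately have A: "2 * card A \<le> card X" by linarith
  have "3 * card (unpeeled X) = (\<Sum>r\<in>unpeeled X. 3)" by simp
  also have "\<dots> \<le> (\<Sum>r\<in>unpeeled X. card (nb r \<inter> X) + (if r \<in> A then 1 else 0))"
  proof (rule sum_mono)
    fix r assume r: "r \<in> unpeeled X"
    then show "3 \<le> card (nb r \<inter> X) + (if r \<in> A then 1 else 0)"
      using deg[OF r] M1[OF r] by (cases "r \<in> A") (auto simp: A_def)
  qed
  also have "\<dots> = (\<Sum>r\<in>unpeeled X. card (nb r \<inter> X)) + card A"
    using A_sub unpeeled_sub finX finite_subset[OF unpeeled_sub finX]
    by (simp add: sum.distrib sum.If_cases Int_absorb1 Collect_mem_eq)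
  also have "(\<Sum>r\<in>unpeeled X. card (nb r \<inter> X)) \<le> (\<Sum>r\<in>X. card (nb r \<inter> X))"
    using finX unpeeled_sub by (intro sum_mono2) auto
  also have "\<dots> \<le> 2 * card X" using X by (intro sum_degrees_le) (auto simp: rest_def)
  finally show ?thesis using A by linarith
qed

text \<open>Levels are numbered from the inside: the vertices peeled last get the smallest level.\<close>

lemma exists_levels:
  assumes "5 ^ L * card X < 6 ^ L" and "X \<subseteq> rest"
  shows "\<exists>lev. \<forall>r\<in>X. lev r < L \<and> card (nb r \<inter> (fringe \<union> {u \<in> X. lev u \<le> lev r})) \<le> 2"
  using assms
proof (induction L arbitrary: X)
  case 0
  then have "X = {}" using finite_rest finite_subset by fastforce
  then show ?case by simp
next
  case (Suc L)
  \<comment> \<open>One round shrinks the set by the factor 5/6, which is traded for one factor in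
    the hypothesis.\<close>
  have "5 ^ L * (6 * card (unpeeled X)) \<le> 5 ^ L * (5 * card X)"
    using card_unpeeled_le[OF Suc.prems(2)] by simp
  also have "\<dots> < 6 * 6 ^ L" using Suc.prems(1) by (simp add: mult.assoc mult.left_commute)
  finally have "5 ^ L * card (unpeeled X) < 6 ^ L" by simp
  moreover have unpeeled_sub: "unpeeled X \<subseteq> X" by (auto simp: unpeeled_def)
  ultimately obtain lev where lev: "\<forall>r\<in>unpeeled X. lev r < L \<and>
      card (nb r \<inter> (fringe \<union> {u \<in> unpeeled X. lev u \<le> lev r})) \<le> 2"
    using Suc.IH[of "unpeeled X"] Suc.prems(2) by auto
  \<comment> \<open>Vertices peeled in this round get level L, above all levels supplied by the
    induction hypothesis; for them the condition concerns all of X.\<close>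
  let ?l = "\<lambda>r. if r \<in> unpeeled X then lev r else L"
  have "?l r < Suc L \<and> card (nb r \<inter> (fringe \<union> {u \<in> X. ?l u \<le> ?l r})) \<le> 2" if r: "r \<in> X" for r
  proof (cases "r \<in> unpeeled X")
    case True
    have "{u \<in> X. ?l u \<le> ?l r} = {u \<in> unpeeled X. lev u \<le> lev r}"
      using lev True unpeeled_sub by auto
    then show ?thesis using lev True by (auto simp: less_Suc_eq)
  next
    case False
    have "{u \<in> X. ?l u \<le> ?l r} = X" using lev False by (auto intro: less_imp_le)
    then have "nb r \<inter> (fringe \<union> {u \<in> X. ?l u \<le> ?l r}) = nb r \<inter> (X \<union> fringe)" by blast
    moreover have "card (nb r \<inter> (X \<union> fringe)) \<le> 2" using False r by (auto simp: unpeeled_def)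
    ultimately show ?thesis using False by simp
  qed
  then show ?case by (intro exI[of _ ?l]) blast
qed

text \<open>Each level is split by a colouring that separates vertices at distance at most 2.
  Vertices with equal key then have disjoint neighbourhoods, which makes the pieces of one stage
  disjoint.\<close>

lemma exists_order:
  assumes "5 ^ L * card (verts T) < 6 ^ L"
  shows "\<exists>key. \<forall>r\<in>rest. key r < L * Suc \<Delta> ^ 2
      \<and> card (nb r \<inter> (fringe \<union> {u \<in> rest. key u \<le> key r})) \<le> 2
      \<and> (\<forall>s\<in>rest. key s = key r \<longrightarrow> s \<noteq> r \<longrightarrow> \<not> adj r s \<and> nb r \<inter> nb s = {})"
proof -
  let ?q = "Suc \<Delta> ^ 2"
  have "card rest \<le> card (verts T)" using finite_verts by (intro card_mono) (auto simp: rest_def)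
  then have "5 ^ L * card rest < 6 ^ L" using assms by (meson le_less_trans mult_le_mono2)
  then obtain lev where lev: "\<forall>r\<in>rest. lev r < L \<and>
      card (nb r \<inter> (fringe \<union> {u \<in> rest. lev u \<le> lev r})) \<le> 2"
    using exists_levels[of L rest] by blast
  have "\<exists>c. \<forall>v\<in>verts T. c v < ?q \<and>
      (\<forall>w\<in>verts T. (v, w) \<in> step ^^ 2 \<longrightarrow> c v = c w \<longrightarrow> v = w)"
    by (rule greedy_colouring[OF finite_verts sym_relpow[OF sym_step] refl_step_power
        card_relpow_image_le[OF card_step_image]])
  then obtain c where c: "\<forall>v\<in>verts T. c v < ?q \<and>
      (\<forall>w\<in>verts T. (v, w) \<in> step ^^ 2 \<longrightarrow> c v = c w \<longrightarrow> v = w)" by blast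
  \<comment> \<open>The lexicographic code of level and colour; since colours are below
    \<open>?q\<close>, division and remainder recover both.\<close>
  define key where "key r = lev r * ?q + c r" for r
  have rest_verts: "r \<in> verts T" if "r \<in> rest" for r using that by (simp add: rest_def)
  have div: "key r div ?q = lev r" "key r mod ?q = c r" if "r \<in> rest" for r
    using c rest_verts[OF that] by (auto simp: key_def)
  have "key r < L * ?q" if r: "r \<in> rest" for r
  proof -
    have "key r < Suc (lev r) * ?q" using c rest_verts[OF r] by (simp add: key_def)
    also have "\<dots> \<le> L * ?q" using lev r by (intro mult_le_mono1) (simp add: Suc_leI)
    finally show ?thesis .
  qed
  moreover have "card (nb r \<inter> (fringe \<union> {u \<in> rest. key u \<le> key r})) \<le> 2" if r: "r \<in> rest" for r
  proof -
    have "{u \<in> rest. key u \<le> key r} \<subseteq> {u \<in> rest. lev u \<le> lev r}"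
      using div r by (metis (no_types, lifting) Collect_mono div_le_mono)
    then have "card (nb r \<inter> (fringe \<union> {u \<in> rest. key u \<le> key r})) \<le>
        card (nb r \<inter> (fringe \<union> {u \<in> rest. lev u \<le> lev r}))"
      by (intro card_mono) auto
    then show ?thesis using lev r by fastforce
  qed
  moreover have "\<not> adj r s \<and> nb r \<inter> nb s = {}"
    if rs: "r \<in> rest" "s \<in> rest" "key s = key r" "s \<noteq> r" for r s
  proof -
    have "c r = c s" using div rs by metis
    then have far: "(r, s) \<notin> step ^^ 2" using c rest_verts rs by metis
    have two: "(r, s) \<in> step ^^ 2" if "(r, x) \<in> step" "(x, s) \<in> step" for x
      using that by (auto simp: numeral_2_eq_2)
    show ?thesis using far two[of s] two adj_step adj_sym step_refl by (meson disjoint_iff in_nb_iff)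
  qed
  ultimately show ?thesis by blast
qed

end

section \<open>Embedding into a pseudorandom graph\<close>

text \<open>
  A \<^emph>\<open>piece\<close> is the set of images of the embedded neighbours of a vertex that is to be embedded. A
  pair \<open>(X, Z)\<close> is a test: some vertex of \<open>Z\<close> must be a common neighbour of a piece in \<open>X\<close>. A fixed test
  fails with probability at most \<open>exp (- p ^ 2 |X| |Z|)\<close>.
\<close>

definition pieces :: "nat \<Rightarrow> nat set set" where
  "pieces n = {S. S \<subseteq> {..<n} \<and> 1 \<le> card S \<and> card S \<le> 2}"

definition hits :: "nat set set \<Rightarrow> nat set set \<Rightarrow> nat set \<Rightarrow> bool" where
  "hits E X Z \<longleftrightarrow> (\<exists>S\<in>X. \<exists>z\<in>Z. \<forall>s\<in>S. {s, z} \<in> E)"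

text \<open>Disjointness of X, and of Z from its union, ensures that different choices of a piece
  and a vertex of Z involve different edges, so their successes are independent.\<close>

definition tests :: "nat \<Rightarrow> nat \<Rightarrow> nat \<Rightarrow> nat set \<Rightarrow> (nat set set \<times> nat set) set" where
  "tests n j u B = {(X, Z). X \<subseteq> pieces n \<and> card X = j \<and> disjoint X \<and>
    Z \<subseteq> B \<and> card Z = u \<and> Z \<inter> \<Union>X = {}}"

definition anchor :: "nat \<Rightarrow> nat set" where "anchor i = {2 * i, 2 * i + 1}"

text \<open>The size m - 2 j is what remains after discarding fewer than j anchors that reach Z and
  at most j anchors that meet Z.\<close>

definition anchor_tests :: "nat \<Rightarrow> nat \<Rightarrow> nat \<Rightarrow> (nat set set \<times> nat set) set" where
  "anchor_tests n m j = {(X, Z). X \<subseteq> anchor ` {..<m} \<and> card X = m - 2 * j \<and>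
    Z \<subseteq> {..<n} \<and> card Z = j \<and> Z \<inter> \<Union>X = {}}"

text \<open>The blocks start after the 2 m vertices used by the anchors; there are t + 1 of them,
  the last one for embedding I.\<close>

definition block :: "nat \<Rightarrow> nat \<Rightarrow> nat \<Rightarrow> nat set" where
  "block m k i = {2 * m + 2 * k * i..<2 * m + 2 * k * Suc i}"

text \<open>
  The three clauses serve Hall's condition for small sets of new vertices (by means of the reserved
  blocks), for large sets, and, in the last stage, for sets that miss only few vertices.
\<close>

definition pseudorandom :: "nat \<Rightarrow> nat \<Rightarrow> nat \<Rightarrow> nat \<Rightarrow> nat set set \<Rightarrow> bool" where
  "pseudorandom n m t k E \<longleftrightarrow>
    (\<forall>j\<in>{1..k}. \<forall>i\<in>{..t}. \<forall>(X, Z)\<in>tests n j (2 * k - j) (block m k i). hits E X Z) \<and>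
    (\<forall>(X, Z)\<in>tests n k k {..<n}. hits E X Z) \<and>
    (\<forall>j\<in>{1..k}. \<forall>(X, Z)\<in>anchor_tests n m j. hits E X Z)"

text \<open>One stage: R holds the new vertices, \<open>S r\<close> the images of the embedded
  neighbours of r, A the available places and B the reserved block. If at most k new vertices
  violated Hall's condition, 2 k - |X| places of B would be missed. From k vertices on, fewer than k
  places of A are missed, which either the surplus k or the covering condition in
  \<open>spare\<close> absorbs.\<close>

lemma exists_matching:
  fixes S :: "'a \<Rightarrow> nat set"
  assumes "finite R" and "1 \<le> k" and A: "A \<subseteq> {..<n}"
    and S: "\<And>r. r \<in> R \<Longrightarrow> S r \<subseteq> {..<n} - A" "\<And>r. r \<in> R \<Longrightarrow> card (S r) \<le> 2"
    and S_disjoint: "\<And>r s. r \<in> R \<Longrightarrow> s \<in> R \<Longrightarrow> r \<noteq> s \<Longrightarrow> S r \<inter> S s = {}"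
    and B: "B \<subseteq> A" "card B = 2 * k"
    and small: "\<And>j X Z. j \<in> {1..k} \<Longrightarrow> (X, Z) \<in> tests n j (2 * k - j) B \<Longrightarrow> hits E X Z"
    and large: "\<And>X Z. (X, Z) \<in> tests n k k {..<n} \<Longrightarrow> hits E X Z"
    and "card R \<le> card A"
    and spare: "card R + k \<le> card A \<or>
      (\<forall>Y\<subseteq>A. card Y < k \<longrightarrow> card Y \<le> card {r \<in> R. \<exists>y\<in>Y. \<forall>s\<in>S r. {s, y} \<in> E})"
  shows "\<exists>g. inj_on g R \<and> (\<forall>r\<in>R. g r \<in> A \<and> (\<forall>s\<in>S r. {s, g r} \<in> E))"
proof -
  define N where "N r = {y \<in> A. \<forall>s\<in>S r. {s, y} \<in> E}" for r
  have finA: "finite A" using A finite_subset by blast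
  have N_sub: "N r \<subseteq> A" for r by (auto simp: N_def)
  have "\<exists>g. inj_on g R \<and> (\<forall>r\<in>R. g r \<in> N r)"
  proof (rule hall_marriage[OF \<open>finite R\<close>])
    show "finite (N r)" for r using finA N_sub finite_subset by blast
    fix X assume X: "X \<subseteq> R"
    have finX: "finite X" using X \<open>finite R\<close> finite_subset by blast
    let ?N = "\<Union>(N ` X)"
    have N_sub': "?N \<subseteq> A" using N_sub by blast
    have finN: "finite ?N" using N_sub' finA finite_subset by blast
    have cardX: "card X \<le> card R" using X \<open>finite R\<close> by (intro card_mono)
    show "card X \<le> card ?N"
    proof (cases "\<exists>r\<in>X. S r = {}")
      case True
      then have "?N = A" using N_sub' by (auto simp: N_def)
      then show ?thesis using cardX \<open>card R \<le> card A\<close> by simp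
    next
      case nonempty: False
      have disj: "disjoint (S ` X')" if "X' \<subseteq> X" for X'
        unfolding disjoint_def using S_disjoint that X by (metis imageE subsetD)
      have inj: "inj_on S X'" if "X' \<subseteq> X" for X'
        using S_disjoint nonempty that X by (intro inj_onI) (metis Int_absorb subsetD)
      have pcs: "S ` X' \<subseteq> pieces n" if "X' \<subseteq> X" for X'
      proof
        fix Q assume "Q \<in> S ` X'"
        then obtain r where r: "r \<in> X" "Q = S r" using \<open>X' \<subseteq> X\<close> by blast
        then have "S r \<subseteq> {..<n}" "S r \<noteq> {}" using S(1) X nonempty by blast+
        then have "1 \<le> card (S r)"
          by (metis One_nat_def Suc_leI card_gt_0_iff finite_lessThan finite_subset)
        then show "Q \<in> pieces n" using r S(2) X \<open>S r \<subseteq> {..<n}\<close> by (auto simp: pieces_def)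
      qed
      have test: "(S ` X', Z) \<in> tests n (card X') (card Z) C"
        if "X' \<subseteq> X" "Z \<subseteq> A" "Z \<subseteq> C" for X' Z C
      proof -
        have "Z \<inter> \<Union>(S ` X') = {}" using that S(1) X by blast
        then show ?thesis
          unfolding tests_def using disj[OF that(1)] pcs[OF that(1)] card_image[OF inj[OF that(1)]] that
          by simp
      qed
      have miss: "\<not> hits E (S ` X') Z" if "X' \<subseteq> X" "Z \<subseteq> A - ?N" for X' Z
        using that by (auto simp: hits_def N_def) blast
      show ?thesis
      proof (cases "card X \<le> k")
        case True
        show ?thesis
        proof (rule ccontr)
          assume lt: "\<not> card X \<le> card ?N"
          have "card (B - ?N) \<ge> card B - card ?N" by (rule diff_card_le_card_Diff[OF finN])
          then have "2 * k - card X \<le> card (B - ?N)" using lt B(2) by linarith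
          then obtain Z where Z: "Z \<subseteq> B - ?N" "card Z = 2 * k - card X"
            using obtain_subset_with_card_n by metis
          have "(S ` X, Z) \<in> tests n (card X) (2 * k - card X) B"
            using test[of X Z B] Z B(1) by auto
          moreover have "card X \<in> {1..k}" using lt True by auto
          ultimately have "hits E (S ` X) Z" by (intro small) auto
          then show False using miss[of X Z] Z B(1) by blast
        qed
      next
        case False
        then have "k \<le> card X" by simp
        then obtain X' where X': "X' \<subseteq> X" "card X' = k"
          using obtain_subset_with_card_n by metis
        have lt: "card (A - ?N) < k"
        proof (rule ccontr)
          assume "\<not> ?thesis"
          then obtain Z where Z: "Z \<subseteq> A - ?N" "card Z = k"
            using obtain_subset_with_card_n by (metis not_less)
          have "(S ` X', Z) \<in> tests n k k {..<n}" using test[of X' Z "{..<n}"] X' Z A by auto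
          then show False using large miss[OF X'(1) Z(1)] by blast
        qed
        have diff: "card (A - ?N) = card A - card ?N" using N_sub' finN
          by (intro card_Diff_subset)
        show ?thesis using spare
        proof
          assume "card R + k \<le> card A"
          then show ?thesis using lt diff cardX by linarith
        next
          assume *: "\<forall>Y\<subseteq>A. card Y < k \<longrightarrow> card Y \<le> card {r \<in> R. \<exists>y\<in>Y. \<forall>s\<in>S r. {s, y} \<in> E}"
          \<comment> \<open>Missed places can only be reached from R - X, so there are at most |R| -
            |X| of them; this suffices because |R| is at most |A|.\<close>
          have "card (A - ?N) \<le> card {r \<in> R. \<exists>y\<in>A - ?N. \<forall>s\<in>S r. {s, y} \<in> E}"
            by (rule *[rule_format, OF Diff_subset lt])
          also have "\<dots> \<le> card (R - X)"
            using \<open>finite R\<close> by (intro card_mono) (auto simp: N_def)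
          also have "\<dots> = card R - card X" using X finX by (intro card_Diff_subset)
          finally show ?thesis using diff \<open>card R \<le> card A\<close> cardX by linarith
        qed
      qed
    qed
  qed
  then show ?thesis by (auto simp: N_def)
qed

text \<open>Otherwise fewer than |Y| anchors reach Y. At most |Y| anchors meet Y, since each vertex
  lies in only one, so m - 2 |Y| others would form a failing anchor test.\<close>

lemma anchors_covered:
  assumes pseudorandom: "pseudorandom n m t k E" and Y: "Y \<subseteq> {..<n}" "card Y \<le> k"
  shows "card Y \<le> card {i. i < m \<and> (\<exists>y\<in>Y. \<forall>s\<in>anchor i. {s, y} \<in> E)}" (is "_ \<le> card ?C")
proof (rule ccontr)
  assume lt: "\<not> ?thesis"
  let ?D = "{i. i < m \<and> anchor i \<inter> Y \<noteq> {}}"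
  have finY: "finite Y" using Y finite_subset by blast
  have "?D \<subseteq> (\<lambda>y. y div 2) ` Y"
  proof
    fix i assume "i \<in> ?D"
    then obtain y where "y \<in> Y" "y = 2 * i \<or> y = 2 * i + 1" by (auto simp: anchor_def)
    then show "i \<in> (\<lambda>y. y div 2) ` Y" by (intro image_eqI[of _ _ y]) auto
  qed
  then have D: "card ?D \<le> card Y" by (rule surj_card_le[OF finY])
  have "card {..<m} - card (?C \<union> ?D) \<le> card ({..<m} - (?C \<union> ?D))"
    by (rule diff_card_le_card_Diff) auto
  moreover have "card (?C \<union> ?D) \<le> card ?C + card ?D" by (rule card_Un_le)
  ultimately have "m - 2 * card Y \<le> card ({..<m} - (?C \<union> ?D))" using lt D by simp
  then obtain G where G: "G \<subseteq> {..<m} - (?C \<union> ?D)" "card G = m - 2 * card Y"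
    by (rule obtain_subset_with_card_n)
  have "inj_on anchor G" by (auto simp: inj_on_def anchor_def doubleton_eq_iff)
  then have "card (anchor ` G) = m - 2 * card Y" using G(2) by (simp add: card_image)
  then have "(anchor ` G, Y) \<in> anchor_tests n m (card Y)"
    using G(1) Y(1) by (auto simp: anchor_tests_def)
  moreover have "card Y \<in> {1..k}" using lt Y(2) by auto
  ultimately have "hits E (anchor ` G) Y" using pseudorandom by (auto simp: pseudorandom_def)
  then show False using G(1) by (auto simp: hits_def)
qed

lemma card_block: "card (block m k i) = 2 * k"
  by (simp add: block_def algebra_simps)

lemma block_disjoint: "i < j \<Longrightarrow> block m k i \<inter> block m k j = {}"
proof -
  assume "i < j"
  then have "2 * k * Suc i \<le> 2 * k * j" by (intro mult_le_mono2) simp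
  then show ?thesis by (auto simp: block_def)
qed

lemma block_bounds: "i \<le> t \<Longrightarrow> block m k i \<subseteq> {2 * m..<2 * m + 2 * k * Suc t}"
proof -
  assume "i \<le> t"
  then have "2 * k * Suc i \<le> 2 * k * Suc t" by (intro mult_le_mono2) simp
  then show ?thesis by (auto simp: block_def)
qed

section \<open>Embedding stage by stage\<close>

context separated_forest
begin

text \<open>Stages 0 to t - 1 embed \<open>rest\<close> in order of \<open>key\<close>, and stage t
  embeds I; each is an application of \<open>exists_matching\<close>. Before the last stage the m
  places kept for I supply the surplus; in the last one the anchors replace it.\<close>

lemma embedding:
  assumes n: "card (verts T) = n" and m: "card I = m" and L: "5 ^ L * n < 6 ^ L"
    and t: "t = L * Suc \<Delta> ^ 2" and k: "1 \<le> k" "4 * k * Suc t \<le> m" and mn: "3 * m \<le> n"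
    and pseudorandom: "pseudorandom n m t k E"
  shows "\<exists>f. bij_betw f (verts T) {..<n} \<and> (\<forall>u v. adj u v \<longrightarrow> {f u, f v} \<in> E)"
proof -
  obtain key where key: "\<And>r. r \<in> rest \<Longrightarrow> key r < t"
    "\<And>r. r \<in> rest \<Longrightarrow> card (nb r \<inter> (fringe \<union> {u \<in> rest. key u \<le> key r})) \<le> 2"
    "\<And>r s. r \<in> rest \<Longrightarrow> s \<in> rest \<Longrightarrow> key s = key r \<Longrightarrow> s \<noteq> r \<Longrightarrow> \<not> adj r s \<and> nb r \<inter> nb s = {}"
    using exists_order[of L] L unfolding n t by blast
  define D where "D i = fringe \<union> {r \<in> rest. key r < i}" for i
  have D_sub: "D i \<subseteq> verts T - I" for i
    using fringe_subset fringe_I_disjoint by (auto simp: D_def rest_def)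
  have finD: "finite (D i)" for i using D_sub finite_verts by (meson finite_Diff finite_subset)
  have card_VI: "card (verts T - I) = n - m"
    using I_subset finite_I n m by (simp add: card_Diff_subset)
  have blocks_small: "2 * k * Suc t + k \<le> m"
  proof -
    have "k * 1 \<le> k * Suc t" by (intro mult_le_mono2) simp
    then show ?thesis using k(2) by (simp add: algebra_simps)
  qed
  have blocks_n: "block m k i \<subseteq> {..<n}" if "i \<le> t" for i
    using block_bounds[OF that] blocks_small mn by fastforce
  have card_blocks: "card (\<Union>(block m k ` {i..t})) \<le> 2 * k * Suc t" for i
  proof -
    have "\<Union>(block m k ` {i..t}) \<subseteq> {2 * m..<2 * m + 2 * k * Suc t}"
      by (intro UN_least block_bounds) simp
    then have "card (\<Union>(block m k ` {i..t})) \<le> card {2 * m..<2 * m + 2 * k * Suc t}"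
      by (intro card_mono) auto
    then show ?thesis by simp
  qed
  obtain idx where idx: "bij_betw idx I {..<m}"
    using finite_I m by (metis finite_same_card_bij card_lessThan finite_lessThan)
  \<comment> \<open>Besides being a partial embedding, f leaves the blocks of the current and all
    later stages free and keeps the neighbours of each vertex of I inside its anchor.\<close>
  define Inv where "Inv i f \<longleftrightarrow> inj_on f (D i) \<and> f ` D i \<subseteq> {..<n} - \<Union>(block m k ` {i..t}) \<and>
      (\<forall>u\<in>D i. \<forall>v\<in>D i. adj u v \<longrightarrow> {f u, f v} \<in> E) \<and> (\<forall>v\<in>I. f ` nb v \<subseteq> anchor (idx v))" for i f
  have "\<exists>f. Inv i f" if "i \<le> t" for i
    using that
  proof (induction i)
    case 0
    have D0: "D 0 = fringe" by (simp add: D_def)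
    have "\<forall>v\<in>I. \<exists>e. inj_on e (nb v) \<and> e ` nb v \<subseteq> {0, 1::nat}"
    proof
      fix v assume "v \<in> I"
      then have "card (nb v) \<le> card {0, 1::nat}" using card_nb_I[of v]
        by (simp add: numeral_2_eq_2)
      then show "\<exists>e. inj_on e (nb v) \<and> e ` nb v \<subseteq> {0, 1::nat}"
        using inj_on_iff_card_le[OF finite_nb[of v], of "{0, 1::nat}"] by simp
    qed
    then obtain e where e: "\<And>v. v \<in> I \<Longrightarrow> inj_on (e v) (nb v)" "\<And>v. v \<in> I \<Longrightarrow> e v ` nb v \<subseteq> {0, 1::nat}"
      by metis
    have "\<forall>a\<in>fringe. \<exists>v\<in>I. adj v a" by (auto simp: fringe_def)
    then obtain own where own: "\<And>a. a \<in> fringe \<Longrightarrow> own a \<in> I" "\<And>a. a \<in> fringe \<Longrightarrow> adj (own a) a"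
      by metis
    have own_eq: "own a = v" if "v \<in> I" "adj v a" for a v
    proof -
      have "a \<in> fringe" using that by (auto simp: fringe_def)
      then have "own a \<in> I" "a \<in> nb (own a) \<inter> nb v" using own that by auto
      then show ?thesis using nb_I_disjoint[of v "own a"] that(1) by blast
    qed
    \<comment> \<open>\<open>own a\<close> is the unique neighbour of a in I, and the value of
      \<open>e\<close> in {0, 1} separates the at most two neighbours of that vertex.\<close>
    define f where "f a = 2 * idx (own a) + e (own a) a" for a
    have e01: "e (own a) a \<le> 1" if "a \<in> fringe" for a
    proof -
      have "e (own a) a \<in> e (own a) ` nb (own a)" using own[OF that] by simp
      then show ?thesis using e(2)[OF own(1)[OF that]] by auto
    qed
    have idx_lt: "idx (own a) < m" if "a \<in> fringe" for a using own(1)[OF that] idx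
      by (auto simp: bij_betw_def)
    have "inj_on f fringe"
    proof (rule inj_onI)
      fix a b assume ab: "a \<in> fringe" "b \<in> fringe" and eq: "f a = f b"
      have "idx (own a) = idx (own b)" "e (own a) a = e (own b) b"
        using e01[OF ab(1)] e01[OF ab(2)] eq unfolding f_def by presburger+
      then have "own a = own b" using idx own(1) ab by (auto simp: bij_betw_def inj_on_def)
      with \<open>e (own a) a = e (own b) b\<close> show "a = b"
        using inj_onD[OF e(1)[OF own(1)[OF ab(1)]], of a b] own(2)[OF ab(1)] own(2)[OF ab(2)]
          \<open>own a = own b\<close> by simp
    qed
    moreover have "f ` fringe \<subseteq> {..<n} - \<Union>(block m k ` {0..t})"
    proof
      fix y assume "y \<in> f ` fringe"
      then obtain a where "a \<in> fringe" "y = f a" by blast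
      then have "y < 2 * m" using e01[of a] idx_lt[of a] by (simp add: f_def)
      then show "y \<in> {..<n} - \<Union>(block m k ` {0..t})" using block_bounds[of _ t m k] mn
        by fastforce
    qed
    moreover have "f ` nb v \<subseteq> anchor (idx v)" if "v \<in> I" for v
    proof
      fix y assume "y \<in> f ` nb v"
      then obtain a where a: "adj v a" "y = f a" by auto
      have "a \<in> fringe" using a(1) that by (auto simp: fringe_def)
      then show "y \<in> anchor (idx v)"
        using e01[of a] own_eq[OF that a(1)] a(2) by (auto simp: f_def anchor_def)
    qed
    ultimately have "Inv 0 f" using fringe_independent by (simp add: Inv_def D0)
    then show ?case by blast
  next
    case (Suc i)
    then obtain f where "Inv i f" by auto
    then have f: "inj_on f (D i)" "f ` D i \<subseteq> {..<n} - \<Union>(block m k ` {i..t})"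
      "\<And>u v. u \<in> D i \<Longrightarrow> v \<in> D i \<Longrightarrow> adj u v \<Longrightarrow> {f u, f v} \<in> E"
      "\<And>v. v \<in> I \<Longrightarrow> f ` nb v \<subseteq> anchor (idx v)"
      by (auto simp: Inv_def)
    define R where "R = {r \<in> rest. key r = i}"
    define S where "S r = f ` (nb r \<inter> D i)" for r
    define A where "A = {..<n} - (f ` D i \<union> \<Union>(block m k ` {Suc i..t}))"
    have finR: "finite R" using finite_rest by (simp add: R_def)
    have D_Suc: "D (Suc i) = D i \<union> R" by (auto simp: D_def R_def)
    have DR: "D i \<inter> R = {}" by (auto simp: D_def R_def rest_def)
    have "card (D i) + card R = card (D (Suc i))"
      unfolding D_Suc using finD finR DR by (simp add: card_Un_disjoint)
    also have "\<dots> \<le> n - m" using D_sub card_VI finite_verts by (metis card_mono finite_Diff)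
    finally have card_DR: "card (D i) + card R + m \<le> n" using mn by linarith
    have "card {..<n} - card (f ` D i \<union> \<Union>(block m k ` {Suc i..t})) \<le> card A"
      unfolding A_def by (rule diff_card_le_card_Diff) (auto simp: finD block_def)
    moreover have "card (f ` D i \<union> \<Union>(block m k ` {Suc i..t})) \<le> card (D i) + 2 * k * Suc t"
      using card_Un_le[of "f ` D i"] card_image_le[OF finD, of f i] card_blocks[of "Suc i"]
      by (meson add_mono le_trans)
    \<comment> \<open>The m places of the vertices of I, which are not yet embedded, pay for the
      reserved blocks and leave a surplus of k.\<close>
    ultimately have card_A: "card R + k \<le> card A" using card_DR blocks_small by simp
    have "\<exists>g. inj_on g R \<and> (\<forall>r\<in>R. g r \<in> A \<and> (\<forall>s\<in>S r. {s, g r} \<in> E))"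
    proof (rule exists_matching[where n = n and B = "block m k i"])
      show "S r \<subseteq> {..<n} - A" for r using f(2) by (auto simp: S_def A_def)
      show "card (S r) \<le> 2" if "r \<in> R" for r
      proof -
        have "card (S r) \<le> card (nb r \<inter> D i)" unfolding S_def by (intro card_image_le) simp
        also have "\<dots> \<le> card (nb r \<inter> (fringe \<union> {u \<in> rest. key u \<le> key r}))"
          using that by (intro card_mono) (auto simp: D_def R_def)
        also have "\<dots> \<le> 2" using that by (intro key(2)) (simp add: R_def)
        finally show ?thesis .
      qed
      show "S r \<inter> S s = {}" if "r \<in> R" "s \<in> R" "r \<noteq> s" for r s
      proof -
        have "nb r \<inter> nb s = {}" using key(3)[of r s] that by (auto simp: R_def)
        then have "f ` ((nb r \<inter> D i) \<inter> (nb s \<inter> D i)) = {}" by blast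
        then show ?thesis
          unfolding S_def by (subst inj_on_image_Int[OF f(1), symmetric]) auto
      qed
      have "block m k i \<inter> \<Union>(block m k ` {Suc i..t}) = {}"
        by (simp add: Int_UN_distrib block_disjoint Suc_le_eq)
      moreover have "f ` D i \<inter> block m k i = {}" using f(2) Suc.prems by fastforce
      ultimately show "block m k i \<subseteq> A" using blocks_n[of i] Suc.prems by (auto simp: A_def)
      show "hits E X Z" if "j \<in> {1..k}" "(X, Z) \<in> tests n j (2 * k - j) (block m k i)" for j X Z
        using pseudorandom that Suc.prems by (fastforce simp: pseudorandom_def)
      show "hits E X Z" if "(X, Z) \<in> tests n k k {..<n}" for X Z
        using pseudorandom that by (fastforce simp: pseudorandom_def)
    qed (use finR k card_A card_block in \<open>auto simp: A_def\<close>)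
    then obtain g where g: "inj_on g R" "\<And>r. r \<in> R \<Longrightarrow> g r \<in> A"
      "\<And>r s. r \<in> R \<Longrightarrow> s \<in> S r \<Longrightarrow> {s, g r} \<in> E" by blast
    define h where "h x = (if x \<in> R then g x else f x)" for x
    have hD: "h x = f x" if "x \<in> D i" for x using that DR by (auto simp: h_def)
    have hR: "h x = g x" if "x \<in> R" for x using that by (simp add: h_def)
    have "inj_on h (D i \<union> R)"
      unfolding inj_on_Un
    proof (intro conjI)
      show "inj_on h (D i)" using f(1) hD by (simp cong: inj_on_cong)
      show "inj_on h R" using g(1) hR by (simp cong: inj_on_cong)
      have "h ` (D i - R) \<subseteq> f ` D i" "h ` (R - D i) \<subseteq> A" using g(2) hD hR by auto
      then show "h ` (D i - R) \<inter> h ` (R - D i) = {}" by (auto simp: A_def)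
    qed
    moreover have "h ` (D i \<union> R) \<subseteq> {..<n} - \<Union>(block m k ` {Suc i..t})"
      using f(2) g(2) hD hR by (fastforce simp: A_def)
    moreover have "{h u, h v} \<in> E" if uv: "u \<in> D i \<union> R" "v \<in> D i \<union> R" "adj u v" for u v
    proof -
      have cross: "{h x, h y} \<in> E" if "x \<in> D i" "y \<in> R" "adj y x" for x y
        using g(3)[of y "f x"] that hD hR by (auto simp: S_def)
      have "\<not> (u \<in> R \<and> v \<in> R)" using key(3)[of u v] uv(3) adj_neq by (auto simp: R_def)
      then show ?thesis
        using uv cross[of u v] cross[of v u] adj_sym f(3) hD by (auto simp: insert_commute)
    qed
    moreover have "h ` nb v \<subseteq> anchor (idx v)" if "v \<in> I" for v
    proof -
      have "nb v \<subseteq> D i" using that by (auto simp: D_def fringe_def)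
      then show ?thesis using f(4)[OF that] hD by auto
    qed
    ultimately have "Inv (Suc i) h" by (simp add: Inv_def D_Suc)
    then show ?case by blast
  qed
  then obtain f where "Inv t f" by blast
  then have f: "inj_on f (D t)" "f ` D t \<subseteq> {..<n} - block m k t"
    "\<And>u v. u \<in> D t \<Longrightarrow> v \<in> D t \<Longrightarrow> adj u v \<Longrightarrow> {f u, f v} \<in> E"
    "\<And>v. v \<in> I \<Longrightarrow> f ` nb v \<subseteq> anchor (idx v)"
    by (auto simp: Inv_def)
  have Dt: "D t = verts T - I" using key(1) fringe_subset fringe_I_disjoint
    by (auto simp: D_def rest_def)
  define A where "A = {..<n} - f ` D t"
  have "card (f ` D t) = n - m" using card_image[OF f(1)] card_VI Dt by simp
  moreover have "card A = card {..<n} - card (f ` D t)"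
    unfolding A_def using f(2) finD by (intro card_Diff_subset) auto
  ultimately have card_A: "card A = m" using mn by simp
  have nb_D: "nb v \<subseteq> D t" if "v \<in> I" for v using that by (auto simp: D_def fringe_def)
  have "\<exists>g. inj_on g I \<and> (\<forall>v\<in>I. g v \<in> A \<and> (\<forall>s\<in>f ` nb v. {s, g v} \<in> E))"
  proof (rule exists_matching[where n = n and B = "block m k t"])
    show "f ` nb v \<subseteq> {..<n} - A" if "v \<in> I" for v
      using f(2) nb_D[OF that] by (auto simp: A_def)
    show "card (f ` nb v) \<le> 2" if "v \<in> I" for v
      using card_nb_I[OF that] card_image_le[OF finite_nb, of f v] by linarith
    show "f ` nb v \<inter> f ` nb w = {}" if "v \<in> I" "w \<in> I" "v \<noteq> w" for v w
      using nb_I_disjoint[OF that] nb_D that(1,2) inj_on_image_Int[OF f(1), of "nb v" "nb w"]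
        by simp
    show "block m k t \<subseteq> A" using f(2) blocks_n[of t] by (auto simp: A_def)
    show "hits E X Z" if "j \<in> {1..k}" "(X, Z) \<in> tests n j (2 * k - j) (block m k t)" for j X Z
      using pseudorandom that by (fastforce simp: pseudorandom_def)
    show "hits E X Z" if "(X, Z) \<in> tests n k k {..<n}" for X Z
      using pseudorandom that by (fastforce simp: pseudorandom_def)
    \<comment> \<open>No surplus is left here. A vertex joined to the whole anchor
      \<open>idx v\<close> is joined to all images of neighbours of v, so
      \<open>anchors_covered\<close> applies whatever T is.\<close>
    have "card Y \<le> card {v \<in> I. \<exists>y\<in>Y. \<forall>s\<in>f ` nb v. {s, y} \<in> E}" (is "_ \<le> card ?C")
      if Y: "Y \<subseteq> A" "card Y < k" for Y
    proof -
      have "Y \<subseteq> {..<n}" using Y(1) by (auto simp: A_def)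
      then have "card Y \<le> card {i. i < m \<and> (\<exists>y\<in>Y. \<forall>s\<in>anchor i. {s, y} \<in> E)}"
        using Y(2) by (intro anchors_covered[OF pseudorandom]) auto
      also have "\<dots> \<le> card (idx ` ?C)"
      proof (rule card_mono)
        show "{i. i < m \<and> (\<exists>y\<in>Y. \<forall>s\<in>anchor i. {s, y} \<in> E)} \<subseteq> idx ` ?C"
        proof
          fix i assume i: "i \<in> {i. i < m \<and> (\<exists>y\<in>Y. \<forall>s\<in>anchor i. {s, y} \<in> E)}"
          then obtain v where "v \<in> I" "i = idx v" using idx by (auto simp: bij_betw_def)
          then show "i \<in> idx ` ?C" using i f(4)[of v] by blast
        qed
      qed (use finite_I in auto)
      also have "\<dots> \<le> card ?C" using finite_I by (intro card_image_le) auto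
      finally show ?thesis .
    qed
    then show "card I + k \<le> card A \<or> (\<forall>Y\<subseteq>A. card Y < k \<longrightarrow>
        card Y \<le> card {v \<in> I. \<exists>y\<in>Y. \<forall>s\<in>f ` nb v. {s, y} \<in> E})" by blast
  qed (use finite_I k card_A m card_block in \<open>auto simp: A_def\<close>)
  then obtain g where g: "inj_on g I" "\<And>v. v \<in> I \<Longrightarrow> g v \<in> A"
    "\<And>v s. v \<in> I \<Longrightarrow> s \<in> f ` nb v \<Longrightarrow> {s, g v} \<in> E" by blast
  define h where "h x = (if x \<in> I then g x else f x)" for x
  have hD: "h x = f x" if "x \<in> D t" for x using that Dt by (auto simp: h_def)
  have hI: "h x = g x" if "x \<in> I" for x using that by (simp add: h_def)
  have V: "verts T = D t \<union> I" using Dt I_subset by blast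
  have "inj_on h (D t \<union> I)"
    unfolding inj_on_Un
  proof (intro conjI)
    show "inj_on h (D t)" using f(1) hD by (simp cong: inj_on_cong)
    show "inj_on h I" using g(1) hI by (simp cong: inj_on_cong)
    have "h ` (D t - I) \<subseteq> f ` D t" "h ` (I - D t) \<subseteq> A" using g(2) hD hI by auto
    then show "h ` (D t - I) \<inter> h ` (I - D t) = {}" by (auto simp: A_def)
  qed
  moreover have "h ` (D t \<union> I) \<subseteq> {..<n}" using f(2) g(2) hD hI by (fastforce simp: A_def)
  ultimately have h: "inj_on h (verts T)" "h ` verts T \<subseteq> {..<n}" by (simp_all only: V)
  have "h ` verts T = {..<n}" by (rule card_subset_eq) (use h n in \<open>simp_all add: card_image\<close>)
  with h have "bij_betw h (verts T) {..<n}" by (simp add: bij_betw_def)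
  moreover have "{h u, h v} \<in> E" if uv: "adj u v" for u v
  proof -
    have cross: "{h x, h y} \<in> E" if "x \<in> D t" "y \<in> I" "adj y x" for x y
      using g(3)[of y "f x"] that hD hI by auto
    have "u \<in> D t \<union> I" "v \<in> D t \<union> I" using adj_verts[OF uv] V by auto
    moreover have "\<not> (u \<in> I \<and> v \<in> I)" using I_independent uv by blast
    ultimately show ?thesis
      using uv cross[of u v] cross[of v u] adj_sym f(3) hD by (auto simp: insert_commute)
  qed
  ultimately show ?thesis by blast
qed

end

section \<open>Pseudorandomness of the random graph\<close>

text \<open>Intersecting with the countable supports reduces this to the product rule for countable
  sets.\<close>

lemma prob_pair_pmf_Times:
  "measure_pmf.prob (pair_pmf P Q) (A \<times> B) = measure_pmf.prob P A * measure_pmf.prob Q B"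
proof -
  have "measure_pmf.prob (pair_pmf P Q) (A \<times> B) =
      measure_pmf.prob (pair_pmf P Q) ((A \<times> B) \<inter> set_pmf (pair_pmf P Q))"
    by (simp only: measure_Int_set_pmf)
  also have "(A \<times> B) \<inter> set_pmf (pair_pmf P Q) = (A \<inter> set_pmf P) \<times> (B \<inter> set_pmf Q)" by auto
  also have "measure_pmf.prob (pair_pmf P Q) \<dots> =
      measure_pmf.prob P (A \<inter> set_pmf P) * measure_pmf.prob Q (B \<inter> set_pmf Q)"
    by (intro measure_pmf_prob_product) (auto intro: countable_subset[OF _ countable_set_pmf])
  finally show ?thesis by (simp add: measure_Int_set_pmf)
qed

text \<open>Disjoint blocks of coordinates are independent, and a block of size at most 2 is
  entirely true with probability at least \<open>p ^ 2\<close>. The induction splits off one block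
  of the product distribution at a time.\<close>

lemma prob_all_blocks_fail:
  fixes F :: "'i \<Rightarrow> 'a set"
  assumes "finite J" and p: "0 \<le> p" "p \<le> 1" and "finite A" "\<And>j. j \<in> J \<Longrightarrow> F j \<subseteq> A"
    and "disjoint_family_on F J" and "\<And>j. j \<in> J \<Longrightarrow> card (F j) \<le> 2"
  shows "measure_pmf.prob (Pi_pmf A False (\<lambda>_. bernoulli_pmf p)) {X. \<forall>j\<in>J. \<exists>e\<in>F j. \<not> X e}
    \<le> (1 - p\<^sup>2) ^ card J"
  using assms(1,4-)
proof (induction J arbitrary: A rule: finite_induct)
  case (insert j J)
  let ?P = "\<lambda>A. Pi_pmf A False (\<lambda>_. bernoulli_pmf p)"
  let ?U = "{X. \<exists>e\<in>F j. \<not> X e}" and ?W = "{X. \<forall>i\<in>J. \<exists>e\<in>F i. \<not> X e}"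
  let ?B = "A - F j" and ?h = "\<lambda>(f, g) x. if x \<in> F j then f x else g x"
  have finF: "finite (F j)" using insert.prems(1,2) finite_subset by blast
  have disj: "F i \<inter> F j = {}" if "i \<in> J" for i
    using disjoint_family_onD[OF insert.prems(3), of i j] that insert.hyps(2) by auto
  have A: "A = F j \<union> ?B" using insert.prems(2) by blast
  have "?P (F j \<union> ?B) = map_pmf ?h (pair_pmf (?P (F j)) (?P ?B))"
    by (rule Pi_pmf_union) (use finF insert.prems(1) in auto)
  then have "?P A = map_pmf ?h (pair_pmf (?P (F j)) (?P ?B))" by (simp only: A[symmetric])
  then have "measure_pmf.prob (?P A) {X. \<forall>i\<in>insert j J. \<exists>e\<in>F i. \<not> X e} =
      measure_pmf.prob (pair_pmf (?P (F j)) (?P ?B)) (?h -` {X. \<forall>i\<in>insert j J. \<exists>e\<in>F i. \<not> X e})"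
    by (simp add: measure_map_pmf)
  also have "?h -` {X. \<forall>i\<in>insert j J. \<exists>e\<in>F i. \<not> X e} = ?U \<times> ?W"
    using disj by (fastforce simp: disjoint_iff)
  also have "measure_pmf.prob (pair_pmf (?P (F j)) (?P ?B)) (?U \<times> ?W) =
      measure_pmf.prob (?P (F j)) ?U * measure_pmf.prob (?P ?B) ?W"
    by (rule prob_pair_pmf_Times)
  also have "\<dots> \<le> (1 - p\<^sup>2) * (1 - p\<^sup>2) ^ card J"
  proof (rule mult_mono)
    have "?U = UNIV - Pi (F j) (\<lambda>_. {True})" by auto
    then have "measure_pmf.prob (?P (F j)) ?U = 1 - measure_pmf.prob (?P (F j)) (Pi (F j) (\<lambda>_. {True}))"
      using measure_pmf.prob_compl[of "Pi (F j) (\<lambda>_. {True})" "?P (F j)"] by simp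
    also have "measure_pmf.prob (?P (F j)) (Pi (F j) (\<lambda>_. {True})) = p ^ card (F j)"
      by (subst measure_Pi_pmf_Pi[OF finF]) (use p in \<open>simp add: measure_pmf_single\<close>)
    finally have "measure_pmf.prob (?P (F j)) ?U = 1 - p ^ card (F j)" .
    moreover have "p\<^sup>2 \<le> p ^ card (F j)" using insert.prems(4)[of j] p
      by (intro power_decreasing) auto
    ultimately show "measure_pmf.prob (?P (F j)) ?U \<le> 1 - p\<^sup>2" by linarith
    show "measure_pmf.prob (?P ?B) ?W \<le> (1 - p\<^sup>2) ^ card J"
    proof (rule insert.IH)
      show "F i \<subseteq> ?B" if "i \<in> J" for i using disj[OF that] insert.prems(2) that by blast
      show "disjoint_family_on F J"
        using insert.prems(3) by (rule disjoint_family_on_mono[rotated]) blast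
    qed (use insert.prems in auto)
    show "0 \<le> 1 - p\<^sup>2" using p by (simp add: power_le_one)
  qed simp
  also have "\<dots> = (1 - p\<^sup>2) ^ card (insert j J)" using insert.hyps by simp
  finally show ?case .
qed simp

lemma prob_not_hits:
  assumes X: "X \<subseteq> pieces n" "disjoint X" and Z: "Z \<subseteq> {..<n}" "Z \<inter> \<Union>X = {}" and p: "0 \<le> p" "p \<le> 1"
  shows "measure_pmf.prob (gnp n p) {G. \<not> hits (edges G) X Z} \<le> exp (- (p\<^sup>2 * real (card X * card Z)))"
proof -
  let ?F = "\<lambda>(S, z). (\<lambda>s. {s, z}) ` S"
  have piece: "S \<subseteq> {..<n}" "card S \<le> 2" if "S \<in> X" for S using X(1) that
    by (auto simp: pieces_def)
  have fin: "finite (vertex_pairs n)" by (simp add: vertex_pairs_def)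
  have finX: "finite X" using X(1) by (rule finite_subset) (simp add: pieces_def)
  have finZ: "finite Z" using Z(1) finite_subset by blast
  have pairs: "{s, z} \<in> vertex_pairs n" if "S \<in> X" "s \<in> S" "z \<in> Z" for S s z
  proof -
    have "s \<noteq> z" "s < n" "z < n" using that Z piece(1)[of S] by auto
    then show ?thesis by (simp add: vertex_pairs_def)
  qed
  have "measure_pmf.prob (gnp n p) {G. \<not> hits (edges G) X Z} =
      measure_pmf.prob (Pi_pmf (vertex_pairs n) False (\<lambda>_. bernoulli_pmf p))
        {Y. \<not> hits {e \<in> vertex_pairs n. Y e} X Z}"
    unfolding gnp_def measure_map_pmf by (simp add: vimage_def)
  also have "{Y. \<not> hits {e \<in> vertex_pairs n. Y e} X Z} = {Y. \<forall>j\<in>X \<times> Z. \<exists>e\<in>?F j. \<not> Y e}"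
    using pairs by (auto simp: hits_def)
  also have "measure_pmf.prob (Pi_pmf (vertex_pairs n) False (\<lambda>_. bernoulli_pmf p)) \<dots>
      \<le> (1 - p\<^sup>2) ^ card (X \<times> Z)"
  proof (rule prob_all_blocks_fail)
    show "disjoint_family_on ?F (X \<times> Z)"
      unfolding disjoint_family_on_def
    proof (intro ballI impI)
      fix a b assume ab: "a \<in> X \<times> Z" "b \<in> X \<times> Z" "a \<noteq> b"
      obtain S z S' z' where eq: "a = (S, z)" "b = (S', z')" by (cases a, cases b)
      \<comment> \<open>z' lies in no piece, so s differs from z' and the two pairs agree
        coordinatewise; then S and S' share an element and are equal.\<close>
      have False if "s \<in> S" "s' \<in> S'" "{s, z} = {s', z'}" for s s'
      proof -
        have "s \<noteq> z'" "s' \<noteq> z" using that ab Z(2) unfolding eq by auto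
        then have "s = s'" "z = z'" using that(3) by (auto simp: doubleton_eq_iff)
        then have "S = S'" using X(2) that ab unfolding eq disjoint_def by blast
        then show False using ab \<open>z = z'\<close> eq by simp
      qed
      then show "?F a \<inter> ?F b = {}" unfolding eq by auto
    qed
    show "?F j \<subseteq> vertex_pairs n" if "j \<in> X \<times> Z" for j using that pairs by auto
    show "card (?F j) \<le> 2" if jXZ: "j \<in> X \<times> Z" for j
    proof -
      obtain S z where j: "j = (S, z)" "S \<in> X" using jXZ by auto
      have "card (?F j) \<le> card S"
        using piece(1)[OF j(2)] finite_subset unfolding j by (auto intro!: card_image_le)
      then show ?thesis using piece(2)[OF j(2)] by linarith
    qed
  qed (use finX finZ fin p in auto)
  also have "\<dots> \<le> exp (- p\<^sup>2) ^ card (X \<times> Z)"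
    using p exp_ge_add_one_self[of "- p\<^sup>2"] by (intro power_mono) (auto simp: power_le_one)
  also have "\<dots> = exp (- (p\<^sup>2 * real (card X * card Z)))"
    by (simp add: card_cartesian_product exp_of_nat_mult[symmetric] mult_ac)
  finally show ?thesis .
qed

text \<open>Union bound: each test fails with probability at most \<open>n ^ (- 6 j)\<close>, and
  there are at most \<open>n ^ (3 j)\<close> tests.\<close>

lemma prob_test_fails:
  assumes "finite \<T>" and card: "card \<T> \<le> n ^ (3 * j)" and p: "0 \<le> p" "p \<le> 1" and "1 \<le> j" "1 \<le> n"
    and tests: "\<And>X Z. (X, Z) \<in> \<T> \<Longrightarrow> X \<subseteq> pieces n \<and> disjoint X \<and> Z \<subseteq> {..<n} \<and> Z \<inter> \<Union>X = {} \<and>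
      j * k \<le> card X * card Z"
    and k: "6 * ln (real n) \<le> p\<^sup>2 * real k"
  shows "measure_pmf.prob (gnp n p) {G. \<exists>(X, Z)\<in>\<T>. \<not> hits (edges G) X Z} \<le> 1 / real n ^ 3"
proof -
  have one: "measure_pmf.prob (gnp n p) {G. \<not> hits (edges G) X Z} \<le> 1 / real n ^ (6 * j)"
    if "(X, Z) \<in> \<T>" for X Z
  proof -
    have "real (6 * j) * ln (real n) = real j * (6 * ln (real n))" by simp
    also have "\<dots> \<le> real j * (p\<^sup>2 * real k)" using k by (intro mult_left_mono) auto
    also have "\<dots> = p\<^sup>2 * real (j * k)" by (simp add: mult_ac)
    also have "\<dots> \<le> p\<^sup>2 * real (card X * card Z)"
      using tests[OF that] by (intro mult_left_mono) (auto simp del: of_nat_mult)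
    finally have le: "real (6 * j) * ln (real n) \<le> p\<^sup>2 * real (card X * card Z)" .
    have "measure_pmf.prob (gnp n p) {G. \<not> hits (edges G) X Z}
        \<le> exp (- (p\<^sup>2 * real (card X * card Z)))"
      using tests[OF that] p by (intro prob_not_hits) auto
    also have "\<dots> \<le> exp (- (real (6 * j) * ln (real n)))" using le by simp
    also have "\<dots> = 1 / real n ^ (6 * j)"
      using \<open>1 \<le> n\<close> by (simp only: exp_minus exp_of_nat_mult) (simp add: divide_inverse)
    finally show ?thesis .
  qed
  have "{G. \<exists>(X, Z)\<in>\<T>. \<not> hits (edges G) X Z} = (\<Union>(X, Z)\<in>\<T>. {G :: nat graph. \<not> hits (edges G) X Z})"
    by auto
  then have "measure_pmf.prob (gnp n p) {G. \<exists>(X, Z)\<in>\<T>. \<not> hits (edges G) X Z}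
      \<le> (\<Sum>(X, Z)\<in>\<T>. measure_pmf.prob (gnp n p) {G. \<not> hits (edges G) X Z})"
    using measure_pmf.finite_measure_subadditive_finite[OF \<open>finite \<T>\<close>,
        of "\<lambda>(X, Z). {G. \<not> hits (edges G) X Z}" "gnp n p"] by (simp add: case_prod_unfold)
  also have "\<dots> \<le> real (card \<T>) * (1 / real n ^ (6 * j))"
    using one by (intro sum_bounded_above) auto
  also have "\<dots> \<le> real (n ^ (3 * j)) * (1 / real n ^ (6 * j))"
    using card by (intro mult_right_mono) (simp_all del: of_nat_power)
  also have "\<dots> = 1 / real n ^ (3 * j)"
  proof -
    have "real n ^ (6 * j) = real n ^ (3 * j) * real n ^ (3 * j)" by (simp flip: power_add)
    then show ?thesis using \<open>1 \<le> n\<close> by simp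
  qed
  also have "\<dots> \<le> 1 / real n ^ 3"
    using \<open>1 \<le> j\<close> \<open>1 \<le> n\<close> by (intro divide_left_mono power_increasing) auto
  finally show ?thesis .
qed

section \<open>Counting the tests\<close>

lemma choose_le_power: "a choose b \<le> a ^ b"
  by (cases "b \<le> a") (auto intro: binomial_le_pow simp: binomial_eq_0)

lemma card_pieces: "finite (pieces n)" "card (pieces n) \<le> n ^ 2"
proof -
  have "pieces n \<subseteq> (\<lambda>(a, b). {a, b}) ` ({..<n} \<times> {..<n})"
  proof
    fix S assume S: "S \<in> pieces n"
    then have "card S = 1 \<or> card S = 2" by (auto simp: pieces_def)
    then obtain a b where "S = {a, b}" by (metis card_1_singletonE card_2_iff insert_absorb2)
    then show "S \<in> (\<lambda>(a, b). {a, b}) ` ({..<n} \<times> {..<n})" using S by (auto simp: pieces_def)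
  qed
  then show "card (pieces n) \<le> n ^ 2" using surj_card_le[of "{..<n} \<times> {..<n}"]
    by (simp add: power2_eq_square)
  show "finite (pieces n)" by (simp add: pieces_def)
qed

text \<open>There are at most \<open>n ^ (2 j)\<close> choices for X. The choices for Z are bounded
  by hypothesis, since for u = 2 k - j inside a block of size 2 k one counts complements of size
  j.\<close>

lemma card_tests:
  assumes "finite B" "card B choose u \<le> n ^ j"
  shows "finite (tests n j u B)" "card (tests n j u B) \<le> n ^ (3 * j)"
proof -
  let ?T = "{X. X \<subseteq> pieces n \<and> card X = j} \<times> {Z. Z \<subseteq> B \<and> card Z = u}"
  have sub: "tests n j u B \<subseteq> ?T" by (auto simp: tests_def)
  have fin: "finite ?T" using assms(1) card_pieces(1) by auto
  then show "finite (tests n j u B)" using sub finite_subset by blast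
  have "card (tests n j u B) \<le> card ?T" using sub fin by (rule card_mono[rotated])
  also have "\<dots> = (card (pieces n) choose j) * (card B choose u)"
    using assms(1) card_pieces(1) by (simp add: card_cartesian_product n_subsets)
  also have "\<dots> \<le> (n ^ 2) ^ j * n ^ j"
    using choose_le_power[of "card (pieces n)" j] power_mono[OF card_pieces(2), of n j] assms(2)
    by (intro mult_le_mono) auto
  also have "\<dots> = n ^ (3 * j)" by (simp add: power_mult[symmetric] power_add[symmetric])
  finally show "card (tests n j u B) \<le> n ^ (3 * j)" .
qed

text \<open>X omits only 2 j anchors, so counting complements gives an exponent proportional to j
  instead of m.\<close>

lemma card_anchor_tests:
  assumes "m \<le> n" "2 * j \<le> m"
  shows "finite (anchor_tests n m j)" "card (anchor_tests n m j) \<le> n ^ (3 * j)"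
proof -
  let ?T = "{X. X \<subseteq> anchor ` {..<m} \<and> card X = m - 2 * j} \<times> {Z. Z \<subseteq> {..<n} \<and> card Z = j}"
  have sub: "anchor_tests n m j \<subseteq> ?T" by (auto simp: anchor_tests_def)
  have fin: "finite ?T" by auto
  then show "finite (anchor_tests n m j)" using sub finite_subset by blast
  have "inj_on anchor {..<m}" by (auto simp: inj_on_def anchor_def doubleton_eq_iff)
  then have card: "card (anchor ` {..<m}) = m" by (simp add: card_image)
  have "card (anchor_tests n m j) \<le> card ?T" using sub fin by (rule card_mono[rotated])
  also have "\<dots> = (m choose (m - 2 * j)) * (n choose j)"
    by (simp add: card_cartesian_product n_subsets card)
  also have "m choose (m - 2 * j) = m choose (2 * j)" using assms(2)
    by (simp add: binomial_symmetric[symmetric])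
  also have "(m choose (2 * j)) * (n choose j) \<le> n ^ (2 * j) * n ^ j"
    using choose_le_power[of m "2 * j"] power_mono[OF assms(1), of "2 * j"] choose_le_power[of n j]
    by (intro mult_le_mono) auto
  also have "\<dots> = n ^ (3 * j)" by (simp add: power_add[symmetric])
  finally show "card (anchor_tests n m j) \<le> n ^ (3 * j)" .
qed

text \<open>The clauses comprise at most 3 n families of tests, and each family contains a failing
  test with probability at most \<open>1 / n ^ 3\<close>.\<close>

lemma prob_pseudorandom:
  assumes p: "0 \<le> p" "p \<le> 1" and k: "1 \<le> k" "4 * k * Suc t \<le> m" and mn: "3 * m \<le> n"
    and kp: "6 * ln (real n) \<le> p\<^sup>2 * real k"
  shows "measure_pmf.prob (gnp n p) {G. pseudorandom n m t k (edges G)} \<ge> 1 - 3 / real n"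
proof -
  define \<C> where "\<C> = (\<lambda>(j, i). tests n j (2 * k - j) (block m k i)) ` ({1..k} \<times> {..t})
    \<union> {tests n k k {..<n}} \<union> anchor_tests n m ` {1..k}"
  define bad where "bad \<T> = {G :: nat graph. \<exists>(X, Z)\<in>\<T>. \<not> hits (edges G) X Z}" for \<T>
  have kt: "k * Suc t \<le> n" and "4 * k \<le> m" and "m \<le> n" and "1 \<le> n"
  proof -
    have "k * 1 \<le> k * Suc t" by (intro mult_le_mono2) simp
    then show "k * Suc t \<le> n" "4 * k \<le> m" "m \<le> n" "1 \<le> n" using k mn by linarith+
  qed
  have finC: "finite \<C>" by (simp add: \<C>_def)
  have "card \<C> \<le> card ((\<lambda>(j, i). tests n j (2 * k - j) (block m k i)) ` ({1..k} \<times> {..t}))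
      + card {tests n k k {..<n}} + card (anchor_tests n m ` {1..k})"
    unfolding \<C>_def by (meson add_le_mono1 card_Un_le le_trans)
  also have "\<dots> \<le> card ({1..k} \<times> {..t}) + 1 + card {1..k}"
    by (intro add_mono card_image_le) auto
  also have "\<dots> = k * Suc t + 1 + k" by (simp add: card_cartesian_product)
  also have "\<dots> \<le> 3 * n" using kt \<open>1 \<le> n\<close> \<open>4 * k \<le> m\<close> \<open>m \<le> n\<close> by linarith
  finally have card_C: "card \<C> \<le> 3 * n" .
  have block_n: "block m k i \<subseteq> {..<n}" if "i \<le> t" for i
  proof -
    have "2 * k * Suc t \<le> m" using k(2) by simp
    then show ?thesis using block_bounds[OF that, of m k] mn by fastforce
  qed
  have fail: "measure_pmf.prob (gnp n p) (bad \<T>) \<le> 1 / real n ^ 3" if TC: "\<T> \<in> \<C>" for \<T>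
  proof -
    consider (a) j i where "j \<in> {1..k}" "i \<le> t" "\<T> = tests n j (2 * k - j) (block m k i)"
      | (b) "\<T> = tests n k k {..<n}" | (c) j where "j \<in> {1..k}" "\<T> = anchor_tests n m j"
      using TC unfolding \<C>_def by blast
    then show ?thesis
    proof cases
      case a
      have "card (block m k i) choose (2 * k - j) = 2 * k choose j"
        using a(1) unfolding card_block by (intro binomial_symmetric[symmetric]) auto
      also have "\<dots> \<le> (2 * k) ^ j" by (rule choose_le_power)
      also have "\<dots> \<le> n ^ j" using \<open>4 * k \<le> m\<close> \<open>m \<le> n\<close> by (intro power_mono) auto
      finally have "card (block m k i) choose (2 * k - j) \<le> n ^ j" .
      note ct = card_tests[OF _ this]
      \<comment> \<open>This is where |X| |Z| reaches j k: j is at most k, so 2 k - j is at least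
        k.\<close>
      have "j * k \<le> j * (2 * k - j)" using a(1) by (intro mult_le_mono2) auto
      then show ?thesis unfolding bad_def a(3) using ct a(1,2) p \<open>1 \<le> n\<close> kp block_n[OF a(2)]
        by (intro prob_test_fails[where j = j and k = k]) (auto simp: tests_def block_def)
    next
      case b
      show ?thesis unfolding bad_def b
        using card_tests[of "{..<n}" k n k] choose_le_power[of n k] k(1) p \<open>1 \<le> n\<close> kp
        by (intro prob_test_fails[where j = k and k = k]) (auto simp: tests_def)
    next
      case c
      have j: "2 * j \<le> m" "k \<le> m - 2 * j" using c(1) \<open>4 * k \<le> m\<close> by auto
      have anchor_piece: "anchor i \<in> pieces n" if "i < m" for i
        using that mn by (auto simp: anchor_def pieces_def)
      have disj: "disjoint (anchor ` {..<m})"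
        by (auto simp: disjoint_def anchor_def) presburger+
      have "X \<subseteq> pieces n \<and> disjoint X \<and> Z \<subseteq> {..<n} \<and> Z \<inter> \<Union>X = {} \<and> j * k \<le> card X * card Z"
        if "(X, Z) \<in> anchor_tests n m j" for X Z
      proof -
        have X: "X \<subseteq> anchor ` {..<m}" using that by (simp add: anchor_tests_def)
        have "X \<subseteq> pieces n" using X anchor_piece by blast
        moreover have "disjoint X" using disj X unfolding disjoint_def by (meson subsetD)
        moreover have "j * k \<le> (m - 2 * j) * j" using j(2) by (simp add: mult.commute)
        ultimately show ?thesis using that by (simp add: anchor_tests_def)
      qed
      then show ?thesis unfolding bad_def c(2)
        using c(1) card_anchor_tests[OF \<open>m \<le> n\<close> j(1)] p \<open>1 \<le> n\<close> kp
        by (intro prob_test_fails[where j = j and k = k]) auto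
    qed
  qed
  have "measure_pmf.prob (gnp n p) (\<Union>(bad ` \<C>)) \<le> (\<Sum>\<T>\<in>\<C>. measure_pmf.prob (gnp n p) (bad \<T>))"
    by (rule measure_pmf.finite_measure_subadditive_finite[OF finC]) simp
  also have "\<dots> \<le> real (card \<C>) * (1 / real n ^ 3)" using fail by (intro sum_bounded_above)
  also have "\<dots> \<le> real (3 * n) * (1 / real n ^ 3)" using card_C by (intro mult_right_mono) auto
  also have "\<dots> = 3 / real n ^ 2" using \<open>1 \<le> n\<close> by (simp add: power_numeral_reduce)
  also have "\<dots> \<le> 3 / real n" using \<open>1 \<le> n\<close>
    by (intro divide_left_mono) (auto simp: power2_eq_square)
  finally have le: "measure_pmf.prob (gnp n p) (\<Union>(bad ` \<C>)) \<le> 3 / real n" .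
  have "pseudorandom n m t k E \<longleftrightarrow> (\<forall>\<T>\<in>\<C>. \<forall>(X, Z)\<in>\<T>. hits E X Z)" for E
    unfolding pseudorandom_def \<C>_def by (simp add: ball_Un) argo
  then have "{G. pseudorandom n m t k (edges G)} = UNIV - \<Union>(bad ` \<C>)"
    by (auto simp: bad_def case_prod_unfold)
  then show ?thesis using le measure_pmf.prob_compl[of "\<Union>(bad ` \<C>)" "gnp n p"] by simp
qed

section \<open>Universality\<close>

text \<open>At least a third of the vertices have degree at most 2, and a ball of radius 6 has at
  most \<open>Suc \<Delta> ^ 6\<close> vertices, so the bound on m allows a greedy choice of
  I.\<close>

lemma pseudorandom_imp_universal:
  assumes pseudorandom: "pseudorandom n m t k (edges G)" and G: "verts G = {..<n}"
    and L: "5 ^ L * n < 6 ^ L" "t = L * Suc \<Delta> ^ 2" and k: "1 \<le> k" "4 * k * Suc t \<le> m"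
    and m: "3 * m * Suc \<Delta> ^ 6 \<le> n"
  shows "universal G (bounded_degree_forests n \<Delta>)"
  unfolding universal_def
proof
  fix T assume "T \<in> bounded_degree_forests n \<Delta>"
  then have T: "forest T" "card (verts T) = n" "\<And>v. v \<in> verts T \<Longrightarrow> degree T v \<le> \<Delta>"
    by (auto simp: bounded_degree_forests_def)
  interpret bounded_forest T \<Delta> using T by unfold_locales
  let ?D = "{v \<in> verts T. card (nb v) \<le> 2}"
  have "m * Suc \<Delta> ^ 6 \<le> card ?D" using m card_low_degree T(2) by linarith
  then have "\<exists>I\<subseteq>?D. card I = m \<and> (\<forall>v\<in>I. \<forall>w\<in>I. (v, w) \<in> step ^^ 6 \<longrightarrow> v = w)"
    using finite_verts
    by (intro greedy_independent[OF _ sym_relpow[OF sym_step] refl_step_power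
        card_relpow_image_le[OF card_step_image]]) auto
  then obtain I where I: "I \<subseteq> ?D" "card I = m" "\<forall>v\<in>I. \<forall>w\<in>I. (v, w) \<in> step ^^ 6 \<longrightarrow> v = w"
    by blast
  interpret separated_forest T \<Delta> I using I by unfold_locales auto
  have "1 \<le> Suc \<Delta> ^ 6" by simp
  then have "3 * m \<le> n" using m by (metis le_trans mult.right_neutral mult_le_mono2)
  then obtain f where f: "bij_betw f (verts T) {..<n}" "\<And>u v. adj u v \<Longrightarrow> {f u, f v} \<in> edges G"
    using embedding[OF T(2) I(2) L k _ pseudorandom] by blast
  have inj: "inj_on f (verts T)" and img: "f ` verts T = {..<n}" using f(1)
    by (auto simp: bij_betw_def)
  have edge: "e \<subseteq> verts T" "card e = 2" if "e \<in> edges T" for e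
    using simple that by (auto simp: simple_graph_def)
  \<comment> \<open>The copy carries only the images of edges of T, because
    \<open>isomorphic\<close> asks for an equivalence and G may have further edges.\<close>
  let ?H = "Graph {..<n} ((`) f ` edges T)"
  have "f ` e \<in> edges G" if eT: "e \<in> edges T" for e
  proof -
    obtain u v where "e = {u, v}" using edge(2)[OF eT] by (auto simp: card_2_iff)
    then show ?thesis using f(2)[of u v] eT by (simp add: adj_def)
  qed
  moreover have "simple_graph ?H"
    using edge img card_image[OF inj_on_subset[OF inj]] by (fastforce simp: simple_graph_def)
  ultimately have "subgraph ?H G" by (auto simp: subgraph_def G)
  moreover have "isomorphic T ?H"
    unfolding isomorphic_def
  proof (intro exI[of _ f] conjI ballI)
    show "bij_betw f (verts T) (verts ?H)" using f(1) by simp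
    fix u v assume uv: "u \<in> verts T" "v \<in> verts T"
    have "{u, v} = e" if "f ` {u, v} = f ` e" "e \<in> edges T" for e
      using inj_on_image_eq_iff[OF inj, of "{u, v}" e] that uv edge(1) by auto
    then have "{u, v} \<in> edges T \<longleftrightarrow> f ` {u, v} \<in> (`) f ` edges T" by blast
    then show "{u, v} \<in> edges T \<longleftrightarrow> {f u, f v} \<in> edges ?H" by simp
  qed
  ultimately show "\<exists>H'. subgraph H' G \<and> isomorphic T H'" by blast
qed

lemma prob_universal:
  assumes p: "0 \<le> p" "p \<le> 1" and L: "5 ^ L * n < 6 ^ L" "t = L * Suc \<Delta> ^ 2"
    and k: "1 \<le> k" "4 * k * Suc t \<le> m" and m: "3 * m * Suc \<Delta> ^ 6 \<le> n"
    and kp: "6 * ln (real n) \<le> p\<^sup>2 * real k"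
  shows "1 - 3 / real n \<le> measure_pmf.prob (gnp n p) {G. universal G (bounded_degree_forests n \<Delta>)}"
proof -
  have "1 \<le> Suc \<Delta> ^ 6" by simp
  then have "3 * m \<le> n" using m by (metis le_trans mult.right_neutral mult_le_mono2)
  then have "1 - 3 / real n \<le> measure_pmf.prob (gnp n p) {G. pseudorandom n m t k (edges G)}"
    using p k kp by (intro prob_pseudorandom)
  \<comment> \<open>Restricting to the support fixes the vertex set, about which
    \<open>pseudorandom\<close> says nothing.\<close>
  also have "\<dots> = measure_pmf.prob (gnp n p) ({G. pseudorandom n m t k (edges G)} \<inter> set_pmf (gnp n p))"
    by (simp only: measure_Int_set_pmf)
  also have "\<dots> \<le> measure_pmf.prob (gnp n p) {G. universal G (bounded_degree_forests n \<Delta>)}"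
  proof (rule measure_pmf.finite_measure_mono)
    have "verts G = {..<n}" if "G \<in> set_pmf (gnp n p)" for G using that by (auto simp: gnp_def)
    then show "{G. pseudorandom n m t k (edges G)} \<inter> set_pmf (gnp n p)
        \<subseteq> {G. universal G (bounded_degree_forests n \<Delta>)}"
      using pseudorandom_imp_universal[OF _ _ L k m] by blast
  qed simp
  finally show ?thesis .
qed

text \<open>From exp (- 1/6) at least 5/6 follows exp (1/6) at most 6/5, so
  \<open>(6 / 5) ^ L\<close> is at least exp (L / 6), which exceeds n.\<close>

lemma five_power_less:
  assumes "1 \<le> n" and "6 * ln (real n) < real L"
  shows "5 ^ L * n < 6 ^ L"
proof -
  have "exp (- (1 / 6)) \<ge> (5 / 6 :: real)" using exp_ge_add_one_self[of "- (1 / 6)"] by simp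
  then have "exp (1 / 6) \<le> (6 / 5 :: real)" by (simp add: exp_minus field_simps)
  have "real n = exp (ln (real n))" using assms(1) by simp
  also have "\<dots> < exp (real L * (1 / 6))" using assms(2) by simp
  also have "\<dots> = exp (1 / 6) ^ L" by (rule exp_of_nat_mult)
  also have "\<dots> \<le> (6 / 5) ^ L" using \<open>exp (1 / 6) \<le> 6 / 5\<close> by (intro power_mono) auto
  finally have "real (5 ^ L * n) < real (6 ^ L)" by (simp add: power_divide field_simps)
  then show ?thesis by (simp only: of_nat_less_iff)
qed

text \<open>With l = ln n, k is at least n / (192 l \<open>\<Delta> ^ 24\<close>) - 1, while
  \<open>p ^ 2 * n\<close> is at least \<open>\<Delta> ^ 24 * l ^ 6\<close>. So
  \<open>p ^ 2 * k\<close> is at least \<open>l ^ 5 / 192 - 1\<close>, which is at least 6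
  l.\<close>

lemma prob_universal_large:
  assumes p: "0 \<le> p" "p \<le> 1" and \<Delta>: "2 \<le> \<Delta>" and n: "8 \<le> ln (real n)"
    and large: "real \<Delta> ^ 12 * real n powr (- 1 / 2) * ln (real n) ^ 3 \<le> p"
  shows "1 - 3 / real n \<le> measure_pmf.prob (gnp n p) {G. universal G (bounded_degree_forests n \<Delta>)}"
proof -
  define l where "l = ln (real n)"
  have l: "8 \<le> l" using n by (simp add: l_def)
  \<comment> \<open>The case n = 0 is excluded because \<open>ln 0 = 0\<close>.\<close>
  have n1: "1 \<le> n" using n by (cases n) auto
  \<comment> \<open>The extra 1 makes \<open>6 * l < L\<close> strict, as
    \<open>five_power_less\<close> requires.\<close>
  define L where "L = nat \<lceil>6 * l\<rceil> + 1"
  define d where "d = Suc \<Delta>"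
  define t where "t = L * d ^ 2"
  define m where "m = n div (3 * d ^ 6)"
  define k where "k = n div (3 * d ^ 6 * (4 * Suc t))"
  have L: "6 * l < real L" "real L \<le> 8 * l" using l unfolding L_def by linarith+
  have d: "1 \<le> d" by (simp add: d_def)
  have m3: "3 * m * d ^ 6 \<le> n"
    using div_times_less_eq_dividend[of n "3 * d ^ 6"] by (simp add: m_def mult_ac)
  have "k = m div (4 * Suc t)" unfolding k_def m_def by (rule div_mult2_eq)
  then have "4 * k * Suc t = m div (4 * Suc t) * (4 * Suc t)" by (simp only: mult_ac)
  then have km: "4 * k * Suc t \<le> m" by (simp only: div_times_less_eq_dividend)
  have np: "real \<Delta> ^ 24 * l ^ 6 \<le> p\<^sup>2 * real n"
  proof -
    have "(real \<Delta> ^ 12 * real n powr (- 1 / 2) * l ^ 3)\<^sup>2 \<le> p\<^sup>2"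
      using large l unfolding l_def by (intro power_mono) auto
    moreover have "(real n powr (- 1 / 2))\<^sup>2 = 1 / real n"
      using n1 by (simp add: power2_eq_square powr_add[symmetric] powr_minus_divide)
    ultimately have "real \<Delta> ^ 24 * (1 / real n) * l ^ 6 \<le> p\<^sup>2"
      by (simp add: power_mult_distrib power_mult[symmetric])
    then show ?thesis using n1 by (simp add: field_simps)
  qed
  have c: "real (3 * d ^ 6 * (4 * Suc t)) \<le> 192 * l * real \<Delta> ^ 24"
  proof -
    have "0 < L * d ^ 2" using d by (intro mult_pos_pos) (simp_all add: L_def)
    then have "Suc t \<le> 2 * (L * d ^ 2)" by (simp add: t_def)
    then have "real (Suc t) \<le> real (2 * (L * d ^ 2))" by (simp only: of_nat_le_iff)
    also have "\<dots> = 2 * real L * real d ^ 2" by simp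
    also have "\<dots> \<le> 2 * (8 * l) * real d ^ 2" using L(2)
      by (intro mult_right_mono mult_left_mono) auto
    finally have t: "real (Suc t) \<le> 16 * l * real d ^ 2" by simp
    \<comment> \<open>As \<Delta> is at least 2, \<Delta> + 1 is at most its square; this turns the
      power \<open>d ^ 8\<close> into a power of \<Delta>.\<close>
    have "d \<le> \<Delta> ^ 2" unfolding d_def power2_eq_square using \<Delta> mult_le_mono1[OF \<Delta>, of \<Delta>]
      by linarith
    then have "d ^ 8 \<le> (\<Delta> ^ 2) ^ 8" by (rule power_mono) simp
    also have "\<dots> = \<Delta> ^ 16" by (simp add: power_mult[symmetric])
    also have "\<dots> \<le> \<Delta> ^ 24" using \<Delta> by (intro power_increasing) auto
    finally have d8: "real d ^ 8 \<le> real \<Delta> ^ 24" by (metis of_nat_le_iff of_nat_power)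
    have "real (3 * d ^ 6 * (4 * Suc t)) = 12 * real d ^ 6 * real (Suc t)" by simp
    also have "\<dots> \<le> 12 * real d ^ 6 * (16 * l * real d ^ 2)" using t by (intro mult_left_mono) auto
    also have "\<dots> = 192 * l * real d ^ 8" by (simp add: power_add[symmetric])
    also have "\<dots> \<le> 192 * l * real \<Delta> ^ 24" using d8 l by (intro mult_left_mono) auto
    finally show ?thesis .
  qed
  define c where "c = real (3 * d ^ 6 * (4 * Suc t))"
  have "0 < c" using d by (simp add: c_def)
  have "\<lfloor>real n / c\<rfloor> = int k" unfolding c_def k_def by (rule floor_divide_of_nat_eq)
  then have kx: "real n / c - 1 \<le> real k" by linarith
  \<comment> \<open>The summand 1 pays for rounding k down, since \<open>p ^ 2\<close> is at most 1.
    From l at least 8 one gets \<open>l ^ 4\<close> at least 4096, and 4096 / 192 exceeds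
    21.\<close>
  have "6 * l + 1 \<le> l ^ 5 / 192"
  proof -
    have "4096 * l \<le> l ^ 4 * l" using power_mono[of 8 l 4] l by (intro mult_right_mono) auto
    moreover have "l ^ 4 * l = l ^ 5" by (simp add: power_numeral_reduce)
    ultimately show ?thesis using l by linarith
  qed
  also have "\<dots> = real \<Delta> ^ 24 * l ^ 6 / (192 * l * real \<Delta> ^ 24)"
    using l \<Delta> by (simp add: power_numeral_reduce field_simps)
  also have "\<dots> \<le> p\<^sup>2 * real n / (192 * l * real \<Delta> ^ 24)"
    using np l by (intro divide_right_mono) auto
  also have "\<dots> \<le> p\<^sup>2 * real n / c"
    using c \<open>0 < c\<close> l \<Delta> unfolding c_def by (intro divide_left_mono mult_pos_pos) auto
  finally have "6 * l + 1 \<le> p\<^sup>2 * (real n / c)" by simp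
  moreover have "p\<^sup>2 * (real n / c - 1) \<le> p\<^sup>2 * real k" using kx by (intro mult_left_mono) auto
  moreover have "p\<^sup>2 \<le> 1" using p by (simp add: power_le_one)
  ultimately have kp: "6 * l \<le> p\<^sup>2 * real k" by (simp add: right_diff_distrib)
  then have "1 \<le> k" using l by (cases k) auto
  show ?thesis
  proof (rule prob_universal[OF p])
    show "5 ^ L * n < 6 ^ L" using n1 L(1) by (intro five_power_less) (auto simp: l_def)
    show "t = L * Suc \<Delta> ^ 2" by (simp add: t_def d_def)
    show "3 * m * Suc \<Delta> ^ 6 \<le> n" using m3 by (simp add: d_def)
    show "6 * ln (real n) \<le> p\<^sup>2 * real k" using kp by (simp add: l_def)
  qed (use km \<open>1 \<le> k\<close> in auto)
qed

theorem corollary1p3: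
  fixes \<Delta> :: "nat \<Rightarrow> nat" and p :: "nat \<Rightarrow> real"
  assumes "\<And>n. n > 0 \<Longrightarrow> \<Delta> n > 1"
    and "\<And>n. n > 0 \<Longrightarrow> p n \<in> {0..1}"
    and "filterlim
      (\<lambda>n. p n / (real (\<Delta> n) ^ 12 * real n powr (- 1 / 2) * ln (real n) ^ 3))
      at_top sequentially"
  shows "(\<lambda>n. measure_pmf.prob (gnp n (p n))
      {G. universal G (bounded_degree_forests n (\<Delta> n))}) \<longlonglongrightarrow> 1"
proof (rule tendsto_sandwich[where h = "\<lambda>_. 1"])
  have "filterlim (\<lambda>n. ln (real n)) at_top sequentially"
    by (rule filterlim_compose[OF ln_at_top filterlim_real_sequentially])
  then have ev_ln: "\<forall>\<^sub>F n in sequentially. 8 \<le> ln (real n)" by (simp add: filterlim_at_top)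
  have ev_p: "\<forall>\<^sub>F n in sequentially.
      1 \<le> p n / (real (\<Delta> n) ^ 12 * real n powr (- 1 / 2) * ln (real n) ^ 3)"
    using assms(3) by (simp add: filterlim_at_top)
  show "\<forall>\<^sub>F n in sequentially. 1 - 3 / real n \<le>
      measure_pmf.prob (gnp n (p n)) {G. universal G (bounded_degree_forests n (\<Delta> n))}"
    using ev_ln ev_p
  proof eventually_elim
    case (elim n)
    then have n: "n > 0" by (cases n) auto
    \<comment> \<open>The denominator must be positive before the quotient bound can be turned into
      a lower bound on \<open>p n\<close>.\<close>
    have "0 < ln (real n)" using elim(1) by linarith
    then have "0 < real (\<Delta> n) ^ 12 * real n powr (- 1 / 2) * ln (real n) ^ 3"
      using n elim(1) assms(1)[OF n] by (intro mult_pos_pos zero_less_power) simp_all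
    then have "real (\<Delta> n) ^ 12 * real n powr (- 1 / 2) * ln (real n) ^ 3 \<le> p n"
      using elim(2) by (simp add: le_divide_eq)
    then show ?case using assms(1,2)[OF n] elim(1) by (intro prob_universal_large) auto
  qed
  show "(\<lambda>n. 1 - 3 / real n) \<longlonglongrightarrow> 1"
    using tendsto_diff[OF tendsto_const[of 1] lim_const_over_n[of "3 :: real"]] by simp
qed simp_all

end
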